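(* Suppose that $N$ is an $\omega$-saturated structure $0$-expanding a structure $M$ that expands an $R$-group $(G,\cdot)$. Let $f: G\to G$ be a group homomorphism definable in $N$. If there exists a finite set $F\subseteq G$ such that for every $g\in G$, $f(g)\in \operatorname{acl}_M(F\cup\{g\})$, then $f$ is definable in $M$. In particular, if $\operatorname{dcl}_N(A)\subseteq \operatorname{acl}_M(A)$ for every $A\subseteq G$, then every group homomorphism $f:G\to G$ definable in $N$ is definable in $M$.
   Context: "Definable" without a specified parameter set means definable with parameters from the structure. For structures $M,N$ with the same universe and a subset $A$ of that universe, $M$ is an $A$-reduct of $N$ (equivalently $N$ is an $A$-expansion of $M$) if every $X\subseteq M^k$ (any $k$) that is $\emptyset$-definable in $M$ is $A$-definable in $N$. When $A$ is the whole universe one says reduct/expansion; when $A=\emptyset$ one says $0$-reduct/$0$-expansion (and "$N$ $0$-expands $M$"). A structure expands a group $(G,\cdot)$ if it is an expansion of the structure $(G,\cdot)$; in particular its universe is $G$. A group $G$ (not necessarily abelian) is an $R$-group if for all $1\le n<\omega$ and $x,y\in G$, $x^n=y^n$ implies $x=y$. $\operatorname{acl}_M$ and $\operatorname{dcl}_N$ denote model-theoretic algebraic closure in $M$ and definable closure in $N$ (in the home sort). *)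

theory Defs
  imports "HOL-Algebra.Group"
begin

section \<open>First-order structures\<close>

record ('f, 'r) language =
  fun_syms :: "'f set"
  rel_syms :: "'r set"
  fun_arity :: "'f \<Rightarrow> nat"
  rel_arity :: "'r \<Rightarrow> nat"

datatype 'f fo_term = Var nat | App 'f "'f fo_term list"

datatype ('f, 'r) fo_formula =
    Equal "'f fo_term" "'f fo_term"
  | Rel 'r "'f fo_term list"
  | Neg "('f, 'r) fo_formula"
  | Conj "('f, 'r) fo_formula" "('f, 'r) fo_formula"
  | Exists nat "('f, 'r) fo_formula"

fun wf_term :: "('f, 'r) language \<Rightarrow> 'f fo_term \<Rightarrow> bool" where
  "wf_term L (Var i) \<longleftrightarrow> True"
| "wf_term L (App f ts) \<longleftrightarrow>
     f \<in> fun_syms L \<and> length ts = fun_arity L f \<and> (\<forall>t\<in>set ts. wf_term L t)"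

fun wf_formula :: "('f, 'r) language \<Rightarrow> ('f, 'r) fo_formula \<Rightarrow> bool" where
  "wf_formula L (Equal s t) \<longleftrightarrow> wf_term L s \<and> wf_term L t"
| "wf_formula L (Rel r ts) \<longleftrightarrow>
     r \<in> rel_syms L \<and> length ts = rel_arity L r \<and> (\<forall>t\<in>set ts. wf_term L t)"
| "wf_formula L (Neg \<phi>) \<longleftrightarrow> wf_formula L \<phi>"
| "wf_formula L (Conj \<phi> \<psi>) \<longleftrightarrow> wf_formula L \<phi> \<and> wf_formula L \<psi>"
| "wf_formula L (Exists i \<phi>) \<longleftrightarrow> wf_formula L \<phi>"

fun fv_term :: "'f fo_term \<Rightarrow> nat set" where
  "fv_term (Var i) = {i}"
| "fv_term (App f ts) = (\<Union>t\<in>set ts. fv_term t)"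

fun fv :: "('f, 'r) fo_formula \<Rightarrow> nat set" where
  "fv (Equal s t) = fv_term s \<union> fv_term t"
| "fv (Rel r ts) = (\<Union>t\<in>set ts. fv_term t)"
| "fv (Neg \<phi>) = fv \<phi>"
| "fv (Conj \<phi> \<psi>) = fv \<phi> \<union> fv \<psi>"
| "fv (Exists i \<phi>) = fv \<phi> - {i}"

text \<open>A structure carries its own language, so that a structure and its reducts may have
  unrelated languages. The interpretations matter only at tuples from the universe of the
  correct length.\<close>

record ('a, 'f, 'r) fo_struct =
  lang :: "('f, 'r) language"
  univ :: "'a set"
  fun_interp :: "'f \<Rightarrow> 'a list \<Rightarrow> 'a"
  rel_interp :: "'r \<Rightarrow> 'a list \<Rightarrow> bool"

definition tuples :: "('a, 'f, 'r) fo_struct \<Rightarrow> nat \<Rightarrow> 'a list set" where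
  "tuples M k = {xs. length xs = k \<and> set xs \<subseteq> univ M}"

definition is_struct :: "('a, 'f, 'r) fo_struct \<Rightarrow> bool" where
  "is_struct M \<longleftrightarrow> univ M \<noteq> {} \<and>
     (\<forall>f\<in>fun_syms (lang M). \<forall>xs\<in>tuples M (fun_arity (lang M) f). fun_interp M f xs \<in> univ M)"

fun eval_term :: "('a, 'f, 'r) fo_struct \<Rightarrow> (nat \<Rightarrow> 'a) \<Rightarrow> 'f fo_term \<Rightarrow> 'a" where
  "eval_term M e (Var i) = e i"
| "eval_term M e (App f ts) = fun_interp M f (map (eval_term M e) ts)"

fun sat :: "('a, 'f, 'r) fo_struct \<Rightarrow> (nat \<Rightarrow> 'a) \<Rightarrow> ('f, 'r) fo_formula \<Rightarrow> bool" where
  "sat M e (Equal s t) \<longleftrightarrow> eval_term M e s = eval_term M e t"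
| "sat M e (Rel r ts) \<longleftrightarrow> rel_interp M r (map (eval_term M e) ts)"
| "sat M e (Neg \<phi>) \<longleftrightarrow> \<not> sat M e \<phi>"
| "sat M e (Conj \<phi> \<psi>) \<longleftrightarrow> sat M e \<phi> \<and> sat M e \<psi>"
| "sat M e (Exists i \<phi>) \<longleftrightarrow> (\<exists>a\<in>univ M. sat M (e(i := a)) \<phi>)"

section \<open>Definability\<close>

text \<open>The variables \<open>0, \<dots>, k - 1\<close> stand for the coordinates and the following ones for the
  parameters. Values of \<open>(!)\<close> beyond the end of the list are irrelevant because of the
  condition on the free variables.\<close>

definition definable_over :: "('a, 'f, 'r) fo_struct \<Rightarrow> 'a set \<Rightarrow> nat \<Rightarrow> 'a list set \<Rightarrow> bool" where
  "definable_over M A k X \<longleftrightarrow>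
     (\<exists>\<phi> as. wf_formula (lang M) \<phi> \<and> set as \<subseteq> A \<and> fv \<phi> \<subseteq> {..<k + length as} \<and>
        X = {xs \<in> tuples M k. sat M (\<lambda>i. (xs @ as) ! i) \<phi>})"

definition definable_map :: "('a, 'f, 'r) fo_struct \<Rightarrow> ('a \<Rightarrow> 'a) \<Rightarrow> bool" where
  "definable_map M f \<longleftrightarrow> definable_over M (univ M) 2 {[x, f x] | x. x \<in> univ M}"

definition expansion_over ::
  "'a set \<Rightarrow> ('a, 'f, 'r) fo_struct \<Rightarrow> ('a, 'g, 's) fo_struct \<Rightarrow> bool" where
  "expansion_over A N M \<longleftrightarrow> univ N = univ M \<and>
     (\<forall>k X. definable_over M {} k X \<longrightarrow> definable_over N A k X)"

definition acl :: "('a, 'f, 'r) fo_struct \<Rightarrow> 'a set \<Rightarrow> 'a set" where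
  "acl M A = {b \<in> univ M. \<exists>X. definable_over M A 1 X \<and> finite X \<and> [b] \<in> X}"

definition dcl :: "('a, 'f, 'r) fo_struct \<Rightarrow> 'a set \<Rightarrow> 'a set" where
  "dcl M A = {b \<in> univ M. definable_over M A 1 {[b]}}"

text \<open>Every (partial) 1-type over a finite set is realized. The finite parameter set is
  listed by \<open>as\<close>; variable \<open>0\<close> is the variable of the type and variable \<open>Suc i\<close> stands for
  the parameter \<open>as ! i\<close>.\<close>

definition omega_saturated :: "('a, 'f, 'r) fo_struct \<Rightarrow> bool" where
  "omega_saturated M \<longleftrightarrow>
     (\<forall>as \<Phi>. set as \<subseteq> univ M \<longrightarrow>
        \<Phi> \<subseteq> {\<phi>. wf_formula (lang M) \<phi> \<and> fv \<phi> \<subseteq> {..length as}} \<longrightarrow>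
        (\<forall>\<Psi>. \<Psi> \<subseteq> \<Phi> \<longrightarrow> finite \<Psi> \<longrightarrow>
           (\<exists>b\<in>univ M. \<forall>\<phi>\<in>\<Psi>. sat M (\<lambda>i. (b # as) ! i) \<phi>)) \<longrightarrow>
        (\<exists>b\<in>univ M. \<forall>\<phi>\<in>\<Phi>. sat M (\<lambda>i. (b # as) ! i) \<phi>))"

section \<open>Groups\<close>

definition group_struct :: "('a, 'b) monoid_scheme \<Rightarrow> ('a, unit, unit) fo_struct" where
  "group_struct G =
     \<lparr>lang = \<lparr>fun_syms = {()}, rel_syms = {}, fun_arity = (\<lambda>_. 2), rel_arity = (\<lambda>_. 0)\<rparr>,
      univ = carrier G,
      fun_interp = (\<lambda>_ xs. xs ! 0 \<otimes>\<^bsub>G\<^esub> xs ! 1),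
      rel_interp = (\<lambda>_ _. False)\<rparr>"

definition expands_group :: "('a, 'f, 'r) fo_struct \<Rightarrow> ('a, 'b) monoid_scheme \<Rightarrow> bool" where
  "expands_group M G \<longleftrightarrow> expansion_over (carrier G) M (group_struct G)"

definition R_group :: "('a, 'b) monoid_scheme \<Rightarrow> bool" where
  "R_group G \<longleftrightarrow> group G \<and>
     (\<forall>n::nat. n \<ge> 1 \<longrightarrow> (\<forall>x\<in>carrier G. \<forall>y\<in>carrier G. x [^]\<^bsub>G\<^esub> n = y [^]\<^bsub>G\<^esub> n \<longrightarrow> x = y))"

end

theory Submission
  imports Defs "HOL-Analysis.Function_Topology"
begin

text \<open>
  Compactness turns the hypothesis on \<open>f\<close> into one relation \<open>X\<close>, definable in \<open>M\<close>, that contains the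
  graph of \<open>f\<close> and has fibres of bounded finite size (\<open>algebraic_map_bounded_relation\<close>). The point
  of the proof is that \<open>X\<close> contains the graphs of only finitely many homomorphisms of \<open>G\<close>, definable
  or not: the equalizer of two homomorphisms of an R-group is closed under taking roots, a group is
  not the union of finitely many proper subgroups of this kind (\<open>root_closed_cover\<close>), and so finitely
  many homomorphisms always take pairwise different values at a common point
  (\<open>R_group_separating_point\<close>), whence their number is bounded by the size of the fibres. In
  particular there is a \<open>d\<close> such that \<open>f\<close> is the only homomorphism with graph inside \<open>X\<close> and with
  value \<open>f d\<close> at \<open>d\<close>.

  So \<open>f\<close> is implicitly defined by data from \<open>M\<close>, and it remains to make the definition explicit, in
  the spirit of Beth's theorem. A pair \<open>(x, y)\<close> from \<open>X\<close> outside the graph of \<open>f\<close> cannot be completed,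
  together with \<open>(d, f d)\<close>, to the graph of a homomorphism inside \<open>X\<close>. As the fibres of \<open>X\<close> are finite,
  Tychonoff's theorem shows that finitely many points already witness this
  (\<open>finite_choice_compactness\<close>, \<open>extendable_imp_hom\<close>). Hence \<open>(x, y)\<close> is refuted in a game of some
  finite length \<open>j\<close> in which points are named one after the other and values have to be found for
  them (\<open>extendable\<close>), and \<open>M\<close> can express this. By saturation of \<open>N\<close>, where \<open>f\<close> is definable, one \<open>j\<close>
  serves for all pairs, and the pairs of \<open>X\<close> that are not refuted in \<open>j\<close> rounds form the graph of \<open>f\<close>,
  now defined in \<open>M\<close> (\<open>algebraic_hom_definable\<close>).
\<close>

section \<open>Coincidence and renaming of variables\<close>

lemma eval_term_cong:
  "(\<And>i. i \<in> fv_term t \<Longrightarrow> e i = e' i) \<Longrightarrow> eval_term M e t = eval_term M e' t"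
proof (induction t)
  case (App f ts)
  then have "map (eval_term M e) ts = map (eval_term M e') ts"
    by (intro map_cong refl) auto
  then show ?case by (simp only: eval_term.simps)
qed simp

lemma sat_cong:
  "(\<And>i. i \<in> fv \<phi> \<Longrightarrow> e i = e' i) \<Longrightarrow> sat M e \<phi> \<longleftrightarrow> sat M e' \<phi>"
proof (induction \<phi> arbitrary: e e')
  case (Equal s t)
  have "eval_term M e s = eval_term M e' s" "eval_term M e t = eval_term M e' t"
    using Equal by (auto intro!: eval_term_cong)
  then show ?case by simp
next
  case (Rel r ts)
  have "map (eval_term M e) ts = map (eval_term M e') ts"
    using Rel.prems by (intro map_cong refl eval_term_cong) auto
  then show ?case by (simp only: sat.simps)
next
  case (Neg \<phi>)
  show ?case using Neg.IH[of e e'] Neg.prems by simp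
next
  case (Conj \<phi> \<psi>)
  show ?case using Conj.IH[of e e'] Conj.prems by simp
next
  case (Exists i \<phi>)
  have "sat M (e(i := a)) \<phi> \<longleftrightarrow> sat M (e'(i := a)) \<phi>" for a
    using Exists.prems by (intro Exists.IH) auto
  then show ?case by simp
qed

lemma finite_fv_term: "finite (fv_term t)"
  by (induction t) auto

lemma finite_fv: "finite (fv \<phi>)"
  by (induction \<phi>) (auto simp: finite_fv_term)

primrec rename_term :: "(nat \<Rightarrow> nat) \<Rightarrow> 'f fo_term \<Rightarrow> 'f fo_term" where
  "rename_term \<rho> (Var i) = Var (\<rho> i)"
| "rename_term \<rho> (App f ts) = App f (map (rename_term \<rho>) ts)"

text \<open>The bound variable becomes \<open>Suc\<close> of the sum of the images of all free variables: this exceeds each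
of these images, so nothing is captured even when \<open>\<rho>\<close> is not injective.\<close>

primrec rename :: "('f, 'r) fo_formula \<Rightarrow> (nat \<Rightarrow> nat) \<Rightarrow> ('f, 'r) fo_formula" where
  "rename (Equal s t) \<rho> = Equal (rename_term \<rho> s) (rename_term \<rho> t)"
| "rename (Rel r ts) \<rho> = Rel r (map (rename_term \<rho>) ts)"
| "rename (Neg \<phi>) \<rho> = Neg (rename \<phi> \<rho>)"
| "rename (Conj \<phi> \<psi>) \<rho> = Conj (rename \<phi> \<rho>) (rename \<psi> \<rho>)"
| "rename (Exists i \<phi>) \<rho> =
     (let k = Suc (sum \<rho> (fv \<phi>)) in Exists k (rename \<phi> (\<rho>(i := k))))"

lemma wf_rename_term: "wf_term L (rename_term \<rho> t) \<longleftrightarrow> wf_term L t"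
  by (induction t) auto

lemma wf_rename: "wf_formula L (rename \<phi> \<rho>) \<longleftrightarrow> wf_formula L \<phi>"
  by (induction \<phi> arbitrary: \<rho>) (auto simp: wf_rename_term Let_def)

lemma fv_rename_term: "fv_term (rename_term \<rho> t) = \<rho> ` fv_term t"
  by (induction t) auto

lemma fresh_rename: "j \<in> fv \<phi> \<Longrightarrow> \<rho> j \<noteq> Suc (sum \<rho> (fv \<phi>))"
  using member_le_sum[of j "fv \<phi>" \<rho>] finite_fv[of \<phi>] by auto

lemma fv_rename: "fv (rename \<phi> \<rho>) = \<rho> ` fv \<phi>"
proof (induction \<phi> arbitrary: \<rho>)
  case (Exists i \<phi>)
  show ?case
    using fresh_rename[of _ \<phi> \<rho>] by (auto simp: Exists.IH Let_def image_iff split: if_splits)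
qed (auto simp: fv_rename_term)

lemma eval_rename_term: "eval_term M e (rename_term \<rho> t) = eval_term M (\<lambda>i. e (\<rho> i)) t"
proof (induction t)
  case (App f ts)
  then have "map (eval_term M e) (map (rename_term \<rho>) ts) = map (eval_term M (\<lambda>i. e (\<rho> i))) ts"
    by auto
  then show ?case by (simp only: eval_term.simps rename_term.simps)
qed simp

lemma sat_rename: "sat M e (rename \<phi> \<rho>) \<longleftrightarrow> sat M (\<lambda>i. e (\<rho> i)) \<phi>"
proof (induction \<phi> arbitrary: e \<rho>)
  case (Rel r ts)
  have "map (eval_term M e) (map (rename_term \<rho>) ts) = map (eval_term M (\<lambda>i. e (\<rho> i))) ts"
    by (simp add: eval_rename_term)
  then show ?case by (simp only: sat.simps rename.simps)
next
  case (Exists i \<phi>)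
  define k where "k = Suc (sum \<rho> (fv \<phi>))"
  have "sat M (\<lambda>j. (e(k := a)) ((\<rho>(i := k)) j)) \<phi> \<longleftrightarrow> sat M ((\<lambda>j. e (\<rho> j))(i := a)) \<phi>" for a
    by (intro sat_cong) (auto simp: k_def dest: fresh_rename)
  then show ?case by (simp add: Let_def Exists.IH flip: k_def)
qed (simp_all add: eval_rename_term)

section \<open>Expressible predicates\<close>

text \<open>A list of parameters with fixed positions is awkward when formulas over different parameters are
combined. Here each variable of the formula is instead told, independently of the others, whether
it stands for a parameter (\<open>Inl\<close>) or for a variable of the environment (\<open>Inr\<close>).\<close>

definition plug :: "(nat \<Rightarrow> 'a + nat) \<Rightarrow> (nat \<Rightarrow> 'a) \<Rightarrow> nat \<Rightarrow> 'a" where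
  "plug \<sigma> e i = (case \<sigma> i of Inl a \<Rightarrow> a | Inr j \<Rightarrow> e j)"

text \<open>Definable relations as predicates on environments, without a fixed arity: adding dummy
variables, permuting coordinates and substituting parameters then are all precompositions.\<close>

definition expressible ::
  "('a, 'f, 'r) fo_struct \<Rightarrow> 'a set \<Rightarrow> ((nat \<Rightarrow> 'a) \<Rightarrow> bool) \<Rightarrow> bool" where
  "expressible M A P \<longleftrightarrow> A \<subseteq> univ M \<and>
     (\<exists>\<phi> \<sigma>. wf_formula (lang M) \<phi> \<and> (\<forall>j a. \<sigma> j = Inl a \<longrightarrow> a \<in> A) \<and>
        (\<forall>e. range e \<subseteq> univ M \<longrightarrow> (P e \<longleftrightarrow> sat M (plug \<sigma> e) \<phi>)))"

lemma expressibleI: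
  assumes "A \<subseteq> univ M" "wf_formula (lang M) \<phi>" "\<And>j a. \<sigma> j = Inl a \<Longrightarrow> a \<in> A"
    "\<And>e. range e \<subseteq> univ M \<Longrightarrow> P e \<longleftrightarrow> sat M (plug \<sigma> e) \<phi>"
  shows "expressible M A P"
  using assms unfolding expressible_def by blast

lemma expressibleE:
  assumes "expressible M A P"
  obtains \<phi> \<sigma> where "A \<subseteq> univ M" "wf_formula (lang M) \<phi>" "\<forall>j a. \<sigma> j = Inl a \<longrightarrow> a \<in> A"
    "\<forall>e. range e \<subseteq> univ M \<longrightarrow> (P e \<longleftrightarrow> sat M (plug \<sigma> e) \<phi>)"
  using assms unfolding expressible_def by blast

lemma expressible_cong:
  assumes "\<And>e. range e \<subseteq> univ M \<Longrightarrow> P e \<longleftrightarrow> Q e"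
  shows "expressible M A P \<longleftrightarrow> expressible M A Q"
  using assms unfolding expressible_def by auto

lemma expressible_mono:
  assumes "expressible M A P" "A \<subseteq> B" "B \<subseteq> univ M"
  shows "expressible M B P"
  using assms unfolding expressible_def by blast

lemma expressible_plug:
  assumes "expressible M A P" and \<tau>: "\<And>j a. \<tau> j = Inl a \<Longrightarrow> a \<in> A"
  shows "expressible M A (\<lambda>e. P (plug \<tau> e))"
proof -
  obtain \<phi> \<sigma> where A: "A \<subseteq> univ M" and \<phi>: "wf_formula (lang M) \<phi>"
    and \<sigma>: "\<forall>j a. \<sigma> j = Inl a \<longrightarrow> a \<in> A"
    and P: "\<forall>e. range e \<subseteq> univ M \<longrightarrow> (P e \<longleftrightarrow> sat M (plug \<sigma> e) \<phi>)"
    by (rule expressibleE[OF assms(1)])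
  note \<sigma> = \<sigma>[rule_format]
  note P = P[rule_format]
  define \<sigma>' where "\<sigma>' j = (case \<sigma> j of Inl a \<Rightarrow> Inl a | Inr i \<Rightarrow> \<tau> i)" for j
  have "plug \<sigma> (plug \<tau> e) = plug \<sigma>' e" for e
    by (auto simp: plug_def \<sigma>'_def fun_eq_iff split: sum.splits)
  moreover have "range (plug \<tau> e) \<subseteq> univ M" if "range e \<subseteq> univ M" for e
  proof safe
    fix i show "plug \<tau> e i \<in> univ M"
      using that \<tau>[of i] A by (cases "\<tau> i") (auto simp: plug_def)
  qed
  ultimately have "P (plug \<tau> e) \<longleftrightarrow> sat M (plug \<sigma>' e) \<phi>" if "range e \<subseteq> univ M" for e
    using that P by simp
  moreover have "a \<in> A" if "\<sigma>' j = Inl a" for j a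
    using that \<sigma> \<tau> by (auto simp: \<sigma>'_def split: sum.splits)
  ultimately show ?thesis using A \<phi> unfolding expressible_def by blast
qed

lemma expressible_rename:
  assumes "expressible M A P"
  shows "expressible M A (\<lambda>e. P (\<lambda>i. e (\<rho> i)))"
  using expressible_plug[OF assms, of "\<lambda>i. Inr (\<rho> i)"] by (simp add: plug_def[abs_def])

lemma expressible_param:
  assumes "expressible M A P" "a \<in> A"
  shows "expressible M A (\<lambda>e. P (case_nat a e))"
proof -
  have "plug (case_nat (Inl a) Inr) e = case_nat a e" for e
    by (auto simp: plug_def fun_eq_iff split: nat.splits)
  moreover have "b \<in> A" if "case_nat (Inl a) Inr j = Inl b" for j b
    using that assms(2) by (auto split: nat.splits)
  ultimately show ?thesis
    using expressible_plug[OF assms(1), of "case_nat (Inl a) Inr"] by simp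
qed

lemma expressible_neg:
  assumes "expressible M A P"
  shows "expressible M A (\<lambda>e. \<not> P e)"
proof -
  obtain \<phi> \<sigma> where P: "A \<subseteq> univ M" "wf_formula (lang M) \<phi>" "\<forall>j a. \<sigma> j = Inl a \<longrightarrow> a \<in> A"
    "\<forall>e. range e \<subseteq> univ M \<longrightarrow> (P e \<longleftrightarrow> sat M (plug \<sigma> e) \<phi>)"
    by (rule expressibleE[OF assms(1)])
  show ?thesis
    by (rule expressibleI[where \<phi> = "Neg \<phi>" and \<sigma> = \<sigma>]) (use P in \<open>simp_all\<close>)
qed

lemma expressible_conj:
  assumes "expressible M A P" "expressible M A Q"
  shows "expressible M A (\<lambda>e. P e \<and> Q e)"
proof -
  obtain \<phi> \<sigma> where P: "A \<subseteq> univ M" "wf_formula (lang M) \<phi>" "\<forall>j a. \<sigma> j = Inl a \<longrightarrow> a \<in> A"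
    "\<forall>e. range e \<subseteq> univ M \<longrightarrow> (P e \<longleftrightarrow> sat M (plug \<sigma> e) \<phi>)"
    by (rule expressibleE[OF assms(1)])
  obtain \<psi> \<tau> where Q: "A \<subseteq> univ M" "wf_formula (lang M) \<psi>" "\<forall>j a. \<tau> j = Inl a \<longrightarrow> a \<in> A"
    "\<forall>e. range e \<subseteq> univ M \<longrightarrow> (Q e \<longleftrightarrow> sat M (plug \<tau> e) \<psi>)"
    by (rule expressibleE[OF assms(2)])
  define \<upsilon> where "\<upsilon> i = (if even i then \<sigma> (i div 2) else \<tau> (i div 2))" for i
  have \<upsilon>: "(\<lambda>i. plug \<upsilon> e (2 * i)) = plug \<sigma> e" "(\<lambda>i. plug \<upsilon> e (Suc (2 * i))) = plug \<tau> e" for e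
    by (auto simp: plug_def \<upsilon>_def)
  show ?thesis
  proof (rule expressibleI)
    show "wf_formula (lang M) (Conj (rename \<phi> (\<lambda>i. 2 * i)) (rename \<psi> (\<lambda>i. Suc (2 * i))))"
      using P(2) Q(2) by (simp add: wf_rename)
    show "a \<in> A" if "\<upsilon> j = Inl a" for j a
      using that P(3) Q(3) by (auto simp: \<upsilon>_def split: if_splits)
    show "P e \<and> Q e \<longleftrightarrow> sat M (plug \<upsilon> e)
        (Conj (rename \<phi> (\<lambda>i. 2 * i)) (rename \<psi> (\<lambda>i. Suc (2 * i))))"
      if "range e \<subseteq> univ M" for e
      using P(4) Q(4) that by (simp add: sat_rename \<upsilon>)
  qed (rule P(1))
qed

text \<open>Quantifiers bind in de Bruijn style: the bound element is put in front of the environment, so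
nested quantifiers need no bookkeeping of fresh variables.\<close>

lemma expressible_ex:
  assumes "expressible M A P"
  shows "expressible M A (\<lambda>e. \<exists>a\<in>univ M. P (case_nat a e))"
proof -
  obtain \<phi> \<sigma> where A: "A \<subseteq> univ M" and \<phi>: "wf_formula (lang M) \<phi>"
    and \<sigma>: "\<forall>j a. \<sigma> j = Inl a \<longrightarrow> a \<in> A"
    and P: "\<forall>e. range e \<subseteq> univ M \<longrightarrow> (P e \<longleftrightarrow> sat M (plug \<sigma> e) \<phi>)"
    by (rule expressibleE[OF assms(1)])
  note \<sigma> = \<sigma>[rule_format]
  note P = P[rule_format]
  \<comment> \<open>\<open>\<sigma>\<close> may send several variables of \<open>\<phi>\<close> to the quantified one; \<open>\<rho>\<close> merges these into variable \<open>0\<close>.\<close>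
  define \<rho> where "\<rho> j = (if \<sigma> j = Inr 0 then 0 else Suc j)" for j
  define \<tau> where "\<tau> = case_nat (Inr 0) (\<lambda>j. case \<sigma> j of Inl a \<Rightarrow> Inl a | Inr i \<Rightarrow> Inr (i - 1))"
  have *: "(\<lambda>j. ((plug \<tau> e)(0 := a)) (\<rho> j)) = plug \<sigma> (case_nat a e)" for e a
    by (auto simp: plug_def \<rho>_def \<tau>_def fun_eq_iff split: sum.splits nat.splits)
  have "range (case_nat a e) \<subseteq> univ M" if "a \<in> univ M" "range e \<subseteq> univ M" for a and e :: "nat \<Rightarrow> 'a"
    using that by (auto simp: image_subset_iff split: nat.splits)
  then have "(\<exists>a\<in>univ M. P (case_nat a e)) \<longleftrightarrow> sat M (plug \<tau> e) (Exists 0 (rename \<phi> \<rho>))"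
    if "range e \<subseteq> univ M" for e
    using that by (simp add: sat_rename * P del: fun_upd_apply)
  then show ?thesis
    using A \<phi> \<sigma> unfolding expressible_def
    by (intro conjI exI[of _ "Exists 0 (rename \<phi> \<rho>)"] exI[of _ \<tau>])
       (simp_all add: wf_rename \<tau>_def split: sum.splits nat.splits del: sat.simps)
qed

lemma expressible_eq:
  assumes "A \<subseteq> univ M"
  shows "expressible M A (\<lambda>e. e i = e j)"
  using assms
  by (intro expressibleI[where \<phi> = "Equal (Var i) (Var j)" and \<sigma> = Inr]) (auto simp: plug_def)

lemma expressible_disj:
  assumes "expressible M A P" "expressible M A Q"
  shows "expressible M A (\<lambda>e. P e \<or> Q e)"
  using expressible_neg[OF expressible_conj[OF assms[THEN expressible_neg]]] by simp

lemma expressible_imp: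
  assumes "expressible M A P" "expressible M A Q"
  shows "expressible M A (\<lambda>e. P e \<longrightarrow> Q e)"
  using expressible_disj[OF expressible_neg[OF assms(1)] assms(2)] by simp

lemma expressible_all:
  assumes "expressible M A P"
  shows "expressible M A (\<lambda>e. \<forall>a\<in>univ M. P (case_nat a e))"
  using expressible_neg[OF expressible_ex[OF expressible_neg[OF assms]]] by simp

lemma expressible_ball:
  assumes "finite I" "A \<subseteq> univ M" "\<And>i. i \<in> I \<Longrightarrow> expressible M A (P i)"
  shows "expressible M A (\<lambda>e. \<forall>i\<in>I. P i e)"
  using assms
proof (induction I rule: finite_induct)
  case empty
  then show ?case using expressible_eq[of A M 0 0] by simp
next
  case (insert i I)
  then show ?case using expressible_conj[of M A "P i" "\<lambda>e. \<forall>i\<in>I. P i e"] by simp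
qed

lemma expressible_bex:
  assumes "finite I" "A \<subseteq> univ M" "\<And>i. i \<in> I \<Longrightarrow> expressible M A (P i)"
  shows "expressible M A (\<lambda>e. \<exists>i\<in>I. P i e)"
  using expressible_neg[OF expressible_ball[OF assms(1,2) expressible_neg[OF assms(3)]]] by simp

text \<open>A set has at most \<open>n + 1\<close> elements iff it is empty or becomes a set of at most \<open>n\<close> elements on
removal of one of its members. The induction has to vary \<open>S\<close>, because the removed element enters
the environment as a new variable.\<close>

lemma expressible_card_le:
  assumes "expressible M A (\<lambda>e. S (\<lambda>i. e (Suc i)) (e 0))"
  shows "expressible M A (\<lambda>e. finite {a \<in> univ M. S e a} \<and> card {a \<in> univ M. S e a} \<le> n)"
  using assms
proof (induction n arbitrary: S)
  case 0
  have "finite X \<and> card X \<le> 0 \<longleftrightarrow> X = {}" for X :: "'a set" by auto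
  moreover have "{a \<in> univ M. S e a} = {} \<longleftrightarrow> (\<forall>a\<in>univ M. \<not> S e a)" for e by auto
  ultimately show ?case using expressible_all[OF expressible_neg[OF 0]] by simp
next
  case (Suc n)
  define S' where "S' e a \<longleftrightarrow> S (\<lambda>i. e (Suc i)) a \<and> a \<noteq> e 0" for e a
  have A: "A \<subseteq> univ M" using Suc.prems by (auto simp: expressible_def)
  have "expressible M A (\<lambda>e. S (\<lambda>i. e (Suc (Suc i))) (e 0))"
    using expressible_rename[OF Suc.prems, of "case_nat 0 (\<lambda>i. Suc (Suc i))"] by simp
  then have "expressible M A (\<lambda>e. S' (\<lambda>i. e (Suc i)) (e 0))"
    unfolding S'_def by (intro expressible_conj expressible_neg expressible_eq A)
  note IH = Suc.IH[OF this]
  have "(finite {a \<in> univ M. S e a} \<and> card {a \<in> univ M. S e a} \<le> Suc n) \<longleftrightarrow>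
      (\<forall>a\<in>univ M. \<not> S e a) \<or> (\<exists>z\<in>univ M. S e z \<and>
        finite {a \<in> univ M. S' (case_nat z e) a} \<and> card {a \<in> univ M. S' (case_nat z e) a} \<le> n)"
    (is "?l \<longleftrightarrow> ?r1 \<or> ?r2") for e
  proof -
    define X where "X = {a \<in> univ M. S e a}"
    have eq: "{a \<in> univ M. S' (case_nat z e) a} = X - {z}" for z
      by (auto simp: S'_def X_def)
    have "?r1 \<longleftrightarrow> X = {}" by (auto simp: X_def)
    moreover have "?r2 \<longleftrightarrow> (\<exists>z\<in>X. finite (X - {z}) \<and> card (X - {z}) \<le> n)"
      by (simp only: eq) (auto simp: X_def)
    moreover have "finite X \<and> card X \<le> Suc n \<longleftrightarrow> X = {} \<or> (\<exists>z\<in>X. finite (X - {z}) \<and> card (X - {z}) \<le> n)"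
      by (cases "finite X") (auto simp: card_Diff_singleton)
    ultimately show ?thesis by (simp only: X_def)
  qed
  moreover have "expressible M A (\<lambda>e. (\<forall>a\<in>univ M. \<not> S e a) \<or> (\<exists>z\<in>univ M. S e z \<and>
        finite {a \<in> univ M. S' (case_nat z e) a} \<and> card {a \<in> univ M. S' (case_nat z e) a} \<le> n))"
    using expressible_disj[OF expressible_all[OF expressible_neg[OF Suc.prems]]
        expressible_ex[OF expressible_conj[OF Suc.prems IH]]] by simp
  ultimately show ?case by simp
qed

section \<open>Expressible predicates and definable sets\<close>

text \<open>Variables beyond the first \<open>k\<close> are made to repeat the last coordinate, which keeps the free
variables of the formula within the required bound.\<close>

lemma expressible_formula:
  assumes "expressible M (set as) P" "0 < k"
  obtains \<phi> where "wf_formula (lang M) \<phi>" "fv \<phi> \<subseteq> {..<k + length as}"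
    "\<forall>xs\<in>tuples M k. sat M (\<lambda>i. (xs @ as) ! i) \<phi> \<longleftrightarrow> P (\<lambda>i. xs ! min i (k - 1))"
proof -
  obtain \<phi> \<sigma> where A: "set as \<subseteq> univ M" and \<phi>: "wf_formula (lang M) \<phi>"
    and \<sigma>: "\<forall>j a. \<sigma> j = Inl a \<longrightarrow> a \<in> set as"
    and P: "\<forall>e. range e \<subseteq> univ M \<longrightarrow> (P e \<longleftrightarrow> sat M (plug \<sigma> e) \<phi>)"
    by (rule expressibleE[OF assms(1)])
  note \<sigma> = \<sigma>[rule_format]
  note P = P[rule_format]
  define idx where "idx a = (SOME i. i < length as \<and> as ! i = a)" for a
  have idx: "idx a < length as \<and> as ! idx a = a" if "a \<in> set as" for a
    unfolding idx_def using that
    by (intro someI_ex[of "\<lambda>i. i < length as \<and> as ! i = a"]) (simp add: in_set_conv_nth)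
  define \<rho> where "\<rho> j = (case \<sigma> j of Inl a \<Rightarrow> k + idx a | Inr i \<Rightarrow> min i (k - 1))" for j
  show ?thesis
  proof (rule that[of "rename \<phi> \<rho>"])
    show "wf_formula (lang M) (rename \<phi> \<rho>)" using \<phi> by (simp add: wf_rename)
    have \<rho>_Inl: "\<rho> j = k + idx a \<and> idx a < length as \<and> as ! idx a = a" if "\<sigma> j = Inl a" for j a
      using that \<sigma>[OF that] idx by (simp add: \<rho>_def)
    have \<rho>_Inr: "\<rho> j = min i (k - 1) \<and> min i (k - 1) < k" if "\<sigma> j = Inr i" for j i
      using that assms(2) by (simp add: \<rho>_def)
    have "\<rho> j < k + length as" for j
      using \<rho>_Inl[of j] \<rho>_Inr[of j] by (cases "\<sigma> j") force+
    then show "fv (rename \<phi> \<rho>) \<subseteq> {..<k + length as}" by (auto simp: fv_rename)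
    show "\<forall>xs\<in>tuples M k. sat M (\<lambda>i. (xs @ as) ! i) (rename \<phi> \<rho>) \<longleftrightarrow> P (\<lambda>i. xs ! min i (k - 1))"
    proof
      fix xs assume "xs \<in> tuples M k"
      then have xs: "length xs = k" "set xs \<subseteq> univ M" by (simp_all add: tuples_def)
      have "(xs @ as) ! \<rho> j = plug \<sigma> (\<lambda>i. xs ! min i (k - 1)) j" for j
      proof (cases "\<sigma> j")
        case (Inl a)
        with \<rho>_Inl[OF Inl] xs(1) show ?thesis by (simp add: plug_def nth_append)
      next
        case (Inr i)
        with \<rho>_Inr[OF Inr] xs(1) show ?thesis by (simp add: plug_def nth_append)
      qed
      moreover have "xs ! min i (k - 1) \<in> univ M" for i
      proof -
        have "min i (k - 1) < length xs" using xs(1) assms(2) by simp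
        from nth_mem[OF this] xs(2) show ?thesis by blast
      qed
      then have "range (\<lambda>i. xs ! min i (k - 1)) \<subseteq> univ M" by blast
      ultimately show "sat M (\<lambda>i. (xs @ as) ! i) (rename \<phi> \<rho>) \<longleftrightarrow> P (\<lambda>i. xs ! min i (k - 1))"
        by (simp add: sat_rename P)
    qed
  qed
qed

text \<open>Only the finitely many free variables of the formula matter, hence only finitely many parameters.\<close>

lemma expressible_finite_params:
  assumes "expressible M A P"
  obtains B where "finite B" "B \<subseteq> A" "expressible M B P"
proof -
  obtain \<phi> \<sigma> where A: "A \<subseteq> univ M" and \<phi>: "wf_formula (lang M) \<phi>"
    and \<sigma>: "\<forall>j a. \<sigma> j = Inl a \<longrightarrow> a \<in> A"
    and P: "\<forall>e. range e \<subseteq> univ M \<longrightarrow> (P e \<longleftrightarrow> sat M (plug \<sigma> e) \<phi>)"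
    by (rule expressibleE[OF assms(1)])
  note \<sigma> = \<sigma>[rule_format]
  note P = P[rule_format]
  define \<tau> where "\<tau> j = (if j \<in> fv \<phi> then \<sigma> j else Inr 0)" for j
  define B where "B = {a. \<exists>j\<in>fv \<phi>. \<sigma> j = Inl a}"
  have "B \<subseteq> (\<lambda>j. projl (\<sigma> j)) ` fv \<phi>"
  proof
    fix a assume "a \<in> B"
    then obtain j where "j \<in> fv \<phi>" "\<sigma> j = Inl a" by (auto simp: B_def)
    then show "a \<in> (\<lambda>j. projl (\<sigma> j)) ` fv \<phi>" by (intro image_eqI[of _ _ j]) simp_all
  qed
  then have "finite B" using finite_fv finite_surj by blast
  moreover have "B \<subseteq> A" using \<sigma> by (auto simp: B_def)
  moreover have "sat M (plug \<sigma> e) \<phi> \<longleftrightarrow> sat M (plug \<tau> e) \<phi>" for e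
    by (intro sat_cong) (simp add: plug_def \<tau>_def)
  then have "expressible M B P"
    using A \<phi> P \<open>B \<subseteq> A\<close>
    by (intro expressibleI[where \<phi> = \<phi> and \<sigma> = \<tau>]) (simp_all add: \<tau>_def B_def split: if_splits, blast+)
  ultimately show ?thesis by (rule that)
qed

lemma expressible_definable:
  assumes "expressible M A (\<lambda>e. map e [0..<k] \<in> X)" "0 < k" "X \<subseteq> tuples M k"
  shows "definable_over M A k X"
proof -
  obtain B where B: "finite B" "B \<subseteq> A" "expressible M B (\<lambda>e. map e [0..<k] \<in> X)"
    using expressible_finite_params[OF assms(1)] .
  obtain as where as: "set as = B" using finite_list[OF B(1)] ..
  obtain \<phi> where \<phi>: "wf_formula (lang M) \<phi>" "fv \<phi> \<subseteq> {..<k + length as}"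
    "\<forall>xs\<in>tuples M k. sat M (\<lambda>i. (xs @ as) ! i) \<phi> \<longleftrightarrow>
        map (\<lambda>i. xs ! min i (k - 1)) [0..<k] \<in> X"
    using expressible_formula[OF B(3)[folded as] assms(2)] by blast
  have "map (\<lambda>i. xs ! min i (k - 1)) [0..<k] = xs" if "xs \<in> tuples M k" for xs
    using that by (auto simp: tuples_def intro!: nth_equalityI)
  then have "X = {xs \<in> tuples M k. sat M (\<lambda>i. (xs @ as) ! i) \<phi>}"
    using \<phi>(3) assms(3) by auto
  then show ?thesis unfolding definable_over_def using \<phi>(1,2) as B(2) by blast
qed

lemma definable_expressible:
  assumes "definable_over M A k X" "A \<subseteq> univ M"
  shows "expressible M A (\<lambda>e. map e [0..<k] \<in> X)"
proof -
  obtain \<phi> as where \<phi>: "wf_formula (lang M) \<phi>" "set as \<subseteq> A" "fv \<phi> \<subseteq> {..<k + length as}"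
    and X: "X = {xs \<in> tuples M k. sat M (\<lambda>i. (xs @ as) ! i) \<phi>}"
    using assms(1) unfolding definable_over_def by blast
  define \<sigma> where "\<sigma> i = (if i < k \<or> k + length as \<le> i then Inr i else Inl (as ! (i - k)))" for i
  have "map e [0..<k] \<in> X \<longleftrightarrow> sat M (plug \<sigma> e) \<phi>" if "range e \<subseteq> univ M" for e
  proof -
    have "map e [0..<k] \<in> tuples M k" using that by (auto simp: tuples_def)
    moreover have "sat M (\<lambda>i. (map e [0..<k] @ as) ! i) \<phi> \<longleftrightarrow> sat M (plug \<sigma> e) \<phi>"
      using \<phi>(3) by (intro sat_cong) (auto simp: plug_def \<sigma>_def nth_append)
    ultimately show ?thesis by (simp add: X)
  qed
  moreover have "a \<in> A" if "\<sigma> j = Inl a" for j a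
  proof -
    have "j - k < length as" "a = as ! (j - k)"
      using that by (auto simp: \<sigma>_def split: if_splits)
    then show ?thesis using \<phi>(2) nth_mem by blast
  qed
  ultimately show ?thesis
    using \<phi>(1) assms(2) by (intro expressibleI[where \<phi> = \<phi> and \<sigma> = \<sigma>])
qed

text \<open>Expansions are described by \<open>\<emptyset>\<close>-definable sets only. Parameters come back because plugging them into
a formula is a precomposition, which commutes with the passage to the set defined by it.\<close>

lemma expressible_expansion:
  fixes M :: "('a, 'f, 'r) fo_struct" and N :: "('a, 'g, 's) fo_struct"
  assumes "expansion_over {} N M" "expressible M A P"
  shows "expressible N A P"
proof -
  obtain \<phi> \<sigma> where A: "A \<subseteq> univ M" and \<phi>: "wf_formula (lang M) \<phi>"
    and \<sigma>: "\<forall>j a. \<sigma> j = Inl a \<longrightarrow> a \<in> A"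
    and P: "\<forall>e. range e \<subseteq> univ M \<longrightarrow> (P e \<longleftrightarrow> sat M (plug \<sigma> e) \<phi>)"
    by (rule expressibleE[OF assms(2)])
  note \<sigma> = \<sigma>[rule_format]
  note P = P[rule_format]
  have U: "univ N = univ M" using assms(1) by (simp add: expansion_over_def)
  obtain k where k: "fv \<phi> \<subseteq> {..<k}"
    using finite_nat_iff_bounded finite_fv by blast
  define X where "X = {xs \<in> tuples M k. sat M (\<lambda>i. xs ! i) \<phi>}"
  have "definable_over M {} k X"
    unfolding definable_over_def X_def using \<phi> k by (intro exI[of _ \<phi>] exI[of _ "[]"]) simp
  then have "definable_over N {} k X" using assms(1) by (auto simp: expansion_over_def)
  then have "expressible N {} (\<lambda>e. map e [0..<k] \<in> X)" by (rule definable_expressible) simp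
  then have "expressible N A (\<lambda>e. map e [0..<k] \<in> X)"
    by (rule expressible_mono) (use A U in auto)
  then have "expressible N A (\<lambda>e. map (plug \<sigma> e) [0..<k] \<in> X)"
    by (rule expressible_plug) (rule \<sigma>)
  moreover have "map (plug \<sigma> e) [0..<k] \<in> X \<longleftrightarrow> P e" if e: "range e \<subseteq> univ N" for e
  proof -
    have "plug \<sigma> e i \<in> univ M" for i
      using e U A \<sigma>[of i] by (cases "\<sigma> i") (auto simp: plug_def)
    then have "map (plug \<sigma> e) [0..<k] \<in> tuples M k" by (auto simp: tuples_def)
    moreover have "sat M (\<lambda>i. map (plug \<sigma> e) [0..<k] ! i) \<phi> \<longleftrightarrow> sat M (plug \<sigma> e) \<phi>"
      using k by (intro sat_cong) auto
    ultimately show ?thesis using P e U by (simp add: X_def)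
  qed
  ultimately show ?thesis
    using expressible_cong[of N "\<lambda>e. map (plug \<sigma> e) [0..<k] \<in> X" P A] by simp
qed

section \<open>Saturation as compactness\<close>

text \<open>Saturation in the form in which it is used, as compactness of the universe: a cover by sets
definable over a common finite set has a finite subcover, since otherwise the complements would
form a finitely satisfiable type that is omitted.\<close>

lemma saturated_finite_subcover:
  fixes N :: "('a, 'g, 's) fo_struct" and D :: "'i \<Rightarrow> 'a \<Rightarrow> bool"
  assumes "omega_saturated N" "finite A" "A \<subseteq> univ N"
    and D: "\<And>i. i \<in> I \<Longrightarrow> expressible N A (\<lambda>e. D i (e 0))"
    and cover: "\<And>x. x \<in> univ N \<Longrightarrow> \<exists>i\<in>I. D i x"
  obtains J where "J \<subseteq> I" "finite J" "\<And>x. x \<in> univ N \<Longrightarrow> \<exists>i\<in>J. D i x"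
proof -
  obtain as where as: "set as = A" using finite_list[OF assms(2)] ..
  have "\<exists>\<phi>. wf_formula (lang N) \<phi> \<and> fv \<phi> \<subseteq> {..length as} \<and>
      (\<forall>b\<in>univ N. sat N (\<lambda>i. (b # as) ! i) \<phi> \<longleftrightarrow> D i b)" if i: "i \<in> I" for i
  proof -
    obtain \<phi> where \<phi>: "wf_formula (lang N) \<phi>" "fv \<phi> \<subseteq> {..<1 + length as}"
      "\<forall>xs\<in>tuples N 1. sat N (\<lambda>i. (xs @ as) ! i) \<phi> \<longleftrightarrow> D i (xs ! min 0 (1 - 1))"
      by (rule expressible_formula[OF D[OF i, folded as] zero_less_one])
    have "sat N (\<lambda>i. (b # as) ! i) \<phi> \<longleftrightarrow> D i b" if "b \<in> univ N" for b
      using bspec[OF \<phi>(3), of "[b]"] that by (simp add: tuples_def)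
    with \<phi>(1,2) show ?thesis by (auto simp: lessThan_Suc_atMost)
  qed
  then obtain F where "\<forall>i\<in>I. wf_formula (lang N) (F i) \<and> fv (F i) \<subseteq> {..length as} \<and>
      (\<forall>b\<in>univ N. sat N (\<lambda>j. (b # as) ! j) (F i) \<longleftrightarrow> D i b)"
    by (rule exE[OF bchoice, OF ballI])
  then have F: "wf_formula (lang N) (F i)" "fv (F i) \<subseteq> {..length as}"
    "\<And>b. b \<in> univ N \<Longrightarrow> sat N (\<lambda>j. (b # as) ! j) (F i) \<longleftrightarrow> D i b" if "i \<in> I" for i
    using that by simp_all
  define \<Phi> where "\<Phi> = (\<lambda>i. Neg (F i)) ` I"
  have "\<not> (\<exists>b\<in>univ N. \<forall>\<phi>\<in>\<Phi>. sat N (\<lambda>i. (b # as) ! i) \<phi>)"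
    using cover F(3) by (auto simp: \<Phi>_def)
  moreover have "\<Phi> \<subseteq> {\<phi>. wf_formula (lang N) \<phi> \<and> fv \<phi> \<subseteq> {..length as}}"
    using F(1,2) unfolding \<Phi>_def by (intro image_subsetI CollectI) simp
  ultimately have "\<not> (\<forall>\<Psi>. \<Psi> \<subseteq> \<Phi> \<longrightarrow> finite \<Psi> \<longrightarrow>
      (\<exists>b\<in>univ N. \<forall>\<phi>\<in>\<Psi>. sat N (\<lambda>i. (b # as) ! i) \<phi>))"
    using assms(1)[unfolded omega_saturated_def, THEN spec[of _ as], THEN spec[of _ \<Phi>]] assms(3) as
    by argo
  then obtain \<Psi> where \<Psi>: "\<Psi> \<subseteq> \<Phi>" "finite \<Psi>"
    "\<not> (\<exists>b\<in>univ N. \<forall>\<phi>\<in>\<Psi>. sat N (\<lambda>i. (b # as) ! i) \<phi>)"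
    unfolding not_all not_imp by (elim exE conjE)
  obtain J where J: "J \<subseteq> I" "finite J" "\<Psi> = (\<lambda>i. Neg (F i)) ` J"
    using finite_subset_image[OF \<Psi>(2,1)[unfolded \<Phi>_def]] by blast
  have "\<exists>i\<in>J. D i x" if x: "x \<in> univ N" for x
  proof -
    obtain i where i: "i \<in> J" "sat N (\<lambda>j. (x # as) ! j) (F i)" using \<Psi>(3) x J(3) by auto
    then have "i \<in> I" using J(1) by auto
    from F(3)[OF this x] x i show ?thesis by auto
  qed
  with J(1,2) show ?thesis by (rule that)
qed

lemma expressible_binary:
  assumes "expressible M A (\<lambda>e. R (e 0) (e 1))"
  shows "expressible M A (\<lambda>e. R (e i) (e j))"
  using expressible_rename[OF assms, of "case_nat i (\<lambda>_. j)"] by simp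

lemma definable_map_iff:
  assumes "f \<in> univ M \<rightarrow> univ M"
  shows "definable_map M f \<longleftrightarrow> expressible M (univ M) (\<lambda>e. f (e 0) = e 1)"
proof -
  let ?X = "{[x, f x] | x. x \<in> univ M}"
  have X: "?X \<subseteq> tuples M 2" using assms by (auto simp: tuples_def)
  have "map e [0..<2] \<in> ?X \<longleftrightarrow> f (e 0) = e 1" if "range e \<subseteq> univ M" for e
    using that by (auto simp: upt_rec)
  then have eq: "expressible M (univ M) (\<lambda>e. map e [0..<2] \<in> ?X) \<longleftrightarrow>
      expressible M (univ M) (\<lambda>e. f (e 0) = e 1)"
    by (rule expressible_cong)
  show ?thesis
  proof
    assume "definable_map M f"
    then have "definable_over M (univ M) 2 ?X" by (simp add: definable_map_def)
    from definable_expressible[OF this] eq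
    show "expressible M (univ M) (\<lambda>e. f (e 0) = e 1)" by simp
  next
    assume "expressible M (univ M) (\<lambda>e. f (e 0) = e 1)"
    with eq have "expressible M (univ M) (\<lambda>e. map e [0..<2] \<in> ?X)" by simp
    then have "definable_over M (univ M) 2 ?X" by (rule expressible_definable) (use X in simp_all)
    then show "definable_map M f" by (simp add: definable_map_def)
  qed
qed

section \<open>Algebraic maps\<close>

text \<open>The parameter \<open>g\<close> is turned into a variable; this is how a family indexed by \<open>g\<close> arises from a
formula over \<open>insert g A\<close>.\<close>

lemma expressible_abstract:
  assumes "expressible M (insert g A) P"
  obtains Q where "expressible M A Q" "\<forall>e. range e \<subseteq> univ M \<longrightarrow> (P e \<longleftrightarrow> Q (case_nat g e))"
proof -
  obtain \<phi> \<sigma> where A: "insert g A \<subseteq> univ M" and \<phi>: "wf_formula (lang M) \<phi>"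
    and \<sigma>: "\<forall>j a. \<sigma> j = Inl a \<longrightarrow> a \<in> insert g A"
    and P: "\<forall>e. range e \<subseteq> univ M \<longrightarrow> (P e \<longleftrightarrow> sat M (plug \<sigma> e) \<phi>)"
    by (rule expressibleE[OF assms])
  define \<tau> where "\<tau> j = (case \<sigma> j of Inl a \<Rightarrow> if a = g then Inr 0 else Inl a | Inr i \<Rightarrow> Inr (Suc i))" for j
  have \<tau>: "plug \<tau> (case_nat g e) = plug \<sigma> e" for e
    by (auto simp: plug_def \<tau>_def fun_eq_iff split: sum.splits)
  have "expressible M A (\<lambda>e. sat M (plug \<tau> e) \<phi>)"
  proof (rule expressibleI)
    show "a \<in> A" if "\<tau> j = Inl a" for j a
      using that \<sigma> by (auto simp: \<tau>_def split: sum.splits if_splits)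
  qed (use A \<phi> in auto)
  moreover have "\<forall>e. range e \<subseteq> univ M \<longrightarrow> (P e \<longleftrightarrow> sat M (plug \<tau> (case_nat g e)) \<phi>)"
    unfolding \<tau> by (rule P)
  ultimately show ?thesis by (rule that)
qed

lemma acl_imp_expressible:
  assumes "b \<in> acl M (F \<union> {g})" "F \<subseteq> univ M" "g \<in> univ M"
  obtains R where "expressible M F (\<lambda>e. R (e 0) (e 1))" "finite {y \<in> univ M. R g y}" "R g b"
proof -
  obtain Y where b: "b \<in> univ M" and Y: "definable_over M (insert g F) 1 Y" "finite Y" "[b] \<in> Y"
    using assms(1) by (auto simp: acl_def)
  have "expressible M (insert g F) (\<lambda>e. map e [0..<1] \<in> Y)"
    using Y(1) by (rule definable_expressible) (use assms in auto)
  then obtain Q where Q: "expressible M F Q"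
    "\<forall>e. range e \<subseteq> univ M \<longrightarrow> (map e [0..<1] \<in> Y \<longleftrightarrow> Q (case_nat g e))"
    by (rule expressible_abstract)
  define R where "R x y \<longleftrightarrow> Q (case_nat x (\<lambda>_. y))" for x y
  have "(\<lambda>i. e (case_nat 0 (\<lambda>_. 1) i)) = case_nat (e 0) (\<lambda>_. e 1)" for e :: "nat \<Rightarrow> 'a"
    by (auto simp: fun_eq_iff split: nat.splits)
  note eq = this
  have "expressible M F (\<lambda>e. Q (\<lambda>i. e (case_nat 0 (\<lambda>_. 1) i)))"
    by (rule expressible_rename[OF Q(1)])
  then have "expressible M F (\<lambda>e. R (e 0) (e 1))" by (simp only: R_def eq)
  moreover have Rg: "R g y \<longleftrightarrow> [y] \<in> Y" if "y \<in> univ M" for y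
    using Q(2)[rule_format, of "\<lambda>_. y"] that by (auto simp: R_def)
  have "finite ((\<lambda>y. [y]) -` Y)"
    using Y(2) by (rule finite_vimageI) (simp add: inj_def)
  then have "finite {y \<in> univ M. R g y}"
    by (rule finite_subset[rotated]) (auto simp: Rg)
  moreover have "R g b" using Rg b Y(3) by simp
  ultimately show ?thesis by (rule that)
qed

text \<open>For each \<open>g\<close>, membership of \<open>f g\<close> in the algebraic closure is witnessed by a relation \<open>R\<close>, definable
in \<open>M\<close> over \<open>F\<close>, whose fibre at \<open>g\<close> is finite, say with \<open>n\<close> elements. Removing from \<open>R\<close> the fibres with
more than \<open>n\<close> elements bounds all fibres uniformly. The sets of points at which a given such
relation contains the graph of \<open>f\<close> are definable in \<open>N\<close> and cover the universe, so by saturation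
finitely many of these relations suffice, and their union is the required \<open>X\<close>.\<close>

lemma algebraic_map_bounded_relation:
  fixes M :: "('a, 'f, 'r) fo_struct" and N :: "('a, 'g, 's) fo_struct"
  assumes NM: "expansion_over {} N M" and sat: "omega_saturated N"
    and F: "finite F" "F \<subseteq> univ M" and f: "f \<in> univ M \<rightarrow> univ M"
    and B: "finite B" "expressible N B (\<lambda>e. f (e 0) = e 1)"
    and acl: "\<And>g. g \<in> univ M \<Longrightarrow> f g \<in> acl M (F \<union> {g})"
  obtains X n where "expressible M F (\<lambda>e. X (e 0) (e 1))"
    "\<forall>x\<in>univ M. finite {y \<in> univ M. X x y} \<and> card {y \<in> univ M. X x y} \<le> n"
    "\<forall>x\<in>univ M. X x (f x)"
proof -
  have U: "univ N = univ M" using NM by (simp add: expansion_over_def)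
  have BU: "B \<subseteq> univ N" using B(2) by (simp add: expressible_def)
  define bdd where "bdd R n \<longleftrightarrow> (\<forall>x\<in>univ M. finite {y \<in> univ M. R x y} \<and> card {y \<in> univ M. R x y} \<le> n)"
    for R n
  define I where "I = {R. expressible M F (\<lambda>e. R (e 0) (e 1)) \<and> (\<exists>n. bdd R n)}"
  have D: "expressible N (F \<union> B) (\<lambda>e. R (e 0) (f (e 0)))" if "R \<in> I" for R
  proof -
    have "expressible N F (\<lambda>e. R (e 0) (e 1))"
      using that by (auto simp: I_def intro: expressible_expansion[OF NM])
    then have R: "expressible N (F \<union> B) (\<lambda>e. R (e 0) (e 1))"
      by (rule expressible_mono) (use F BU U in auto)
    have f': "expressible N (F \<union> B) (\<lambda>e. f (e 0) = e 1)"
      using B(2) by (rule expressible_mono) (use F BU U in auto)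
    have "expressible N (F \<union> B) (\<lambda>e. f (e 1) = e 0 \<and> R (e 1) (e 0))"
      by (rule expressible_conj[OF expressible_binary[OF f', of 1 0] expressible_binary[OF R, of 1 0]])
    from expressible_ex[OF this]
    have *: "expressible N (F \<union> B) (\<lambda>e. \<exists>a\<in>univ N. f (e 0) = a \<and> R (e 0) a)" by simp
    have "(\<exists>a\<in>univ N. f (e 0) = a \<and> R (e 0) a) \<longleftrightarrow> R (e 0) (f (e 0))" if "range e \<subseteq> univ N" for e
    proof -
      have "e 0 \<in> univ M" using that U by auto
      with f have "f (e 0) \<in> univ N" using U by (metis PiE)
      then show ?thesis by auto
    qed
    then show ?thesis using * by (rule expressible_cong[THEN iffD1])
  qed
  have cover: "\<exists>R\<in>I. R g (f g)" if "g \<in> univ N" for g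
  proof -
    have g: "g \<in> univ M" using that U by simp
    obtain R where R: "expressible M F (\<lambda>e. R (e 0) (e 1))" "finite {y \<in> univ M. R g y}" "R g (f g)"
      by (rule acl_imp_expressible[OF acl[OF g] F(2) g])
    define n where "n = card {y \<in> univ M. R g y}"
    define R' where "R' x y \<longleftrightarrow> R x y \<and> finite {y \<in> univ M. R x y} \<and> card {y \<in> univ M. R x y} \<le> n" for x y
    have "expressible M F (\<lambda>e. R (e (Suc 0)) (e 0))"
      by (rule expressible_binary[OF R(1)])
    then have "expressible M F (\<lambda>e. finite {y \<in> univ M. R (e 0) y} \<and> card {y \<in> univ M. R (e 0) y} \<le> n)"
      by (rule expressible_card_le)
    with R(1) have "expressible M F (\<lambda>e. R' (e 0) (e 1))"
      unfolding R'_def by (rule expressible_conj)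
    moreover have "bdd R' n" unfolding bdd_def
    proof
      fix x assume "x \<in> univ M"
      show "finite {y \<in> univ M. R' x y} \<and> card {y \<in> univ M. R' x y} \<le> n"
      proof (cases "finite {y \<in> univ M. R x y} \<and> card {y \<in> univ M. R x y} \<le> n")
        case True
        then show ?thesis by (simp add: R'_def)
      next
        case False
        then have "{y \<in> univ M. R' x y} = {}" by (auto simp: R'_def)
        then show ?thesis by (metis card.empty finite.emptyI le0)
      qed
    qed
    ultimately have "R' \<in> I" by (auto simp: I_def)
    moreover have "R' g (f g)" using R(2,3) by (simp add: R'_def n_def)
    ultimately show ?thesis by (intro bexI[of _ R'])
  qed
  obtain J where J: "J \<subseteq> I" "finite J" "\<And>x. x \<in> univ N \<Longrightarrow> \<exists>R\<in>J. R x (f x)"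
  proof (rule saturated_finite_subcover[OF sat, of "F \<union> B" I "\<lambda>R x. R x (f x)"])
    show "finite (F \<union> B)" "F \<union> B \<subseteq> univ N" using F B(1) BU U by auto
  qed (use D cover in blast)+
  define X where "X x y \<longleftrightarrow> (\<exists>R\<in>J. R x y)" for x y
  have "\<forall>R\<in>J. \<exists>n. bdd R n" using J(1) by (auto simp: I_def)
  then obtain b where b: "\<forall>R\<in>J. bdd R (b R)" by (rule exE[OF bchoice])
  have "expressible M F (\<lambda>e. X (e 0) (e 1))"
    unfolding X_def by (rule expressible_bex) (use J F in \<open>auto simp: I_def\<close>)
  moreover have "finite {y \<in> univ M. X x y} \<and> card {y \<in> univ M. X x y} \<le> sum b J"
    if x: "x \<in> univ M" for x
  proof -
    have eq: "{y \<in> univ M. X x y} = (\<Union>R\<in>J. {y \<in> univ M. R x y})" by (auto simp: X_def)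
    have "finite {y \<in> univ M. R x y} \<and> card {y \<in> univ M. R x y} \<le> b R" if "R \<in> J" for R
      using b x that by (auto simp: bdd_def)
    then have "finite (\<Union>R\<in>J. {y \<in> univ M. R x y})"
      "(\<Sum>R\<in>J. card {y \<in> univ M. R x y}) \<le> sum b J"
      using J(2) by (auto intro: sum_mono)
    with card_UN_le[OF J(2), of "\<lambda>R. {y \<in> univ M. R x y}"] show ?thesis unfolding eq by linarith
  qed
  then have "\<forall>x\<in>univ M. finite {y \<in> univ M. X x y} \<and> card {y \<in> univ M. X x y} \<le> sum b J" by blast
  moreover have "\<forall>x\<in>univ M. X x (f x)" using J(3) U by (auto simp: X_def)
  ultimately show ?thesis by (rule that)
qed

section \<open>Homomorphisms of R-groups\<close>

text \<open>A substitute for Neumann's lemma on covers by cosets, made elementary by closure under roots.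
In a cover from which \<open>H\<close> cannot be omitted, choose \<open>x\<close> in \<open>H\<close> and in no other member. If \<open>y\<close> were not
in \<open>H\<close>, then all the elements \<open>x\<^sup>k y\<close> would lie in the finitely many other members; two of them would
lie in the same one, \<open>K\<close>, and their quotient would be a positive power of \<open>x\<close> in \<open>K\<close>, so that \<open>x\<close> would
lie in \<open>K\<close> as well.\<close>

lemma (in group) root_closed_cover:
  assumes "finite \<H>" "\<And>H. H \<in> \<H> \<Longrightarrow> subgroup H G"
    and "\<And>H x n. H \<in> \<H> \<Longrightarrow> x \<in> carrier G \<Longrightarrow> 0 < n \<Longrightarrow> x [^] (n::nat) \<in> H \<Longrightarrow> x \<in> H"
    and "carrier G \<subseteq> \<Union>\<H>"
  shows "carrier G \<in> \<H>"
  using assms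
proof (induction \<H> rule: finite_induct)
  case empty
  then show ?case using one_closed by blast
next
  case (insert H \<H>)
  show ?case
  proof (cases "carrier G \<subseteq> \<Union>\<H>")
    case True
    then have "carrier G \<in> \<H>" using insert.prems by (intro insert.IH) auto
    then show ?thesis by simp
  next
    case False
    then obtain x where x: "x \<in> carrier G" "x \<notin> \<Union>\<H>" by blast
    with insert.prems(3) have xH: "x \<in> H" by auto
    have H: "subgroup H G" using insert.prems(1) by simp
    have "carrier G \<subseteq> H"
    proof
      fix y assume y: "y \<in> carrier G"
      show "y \<in> H"
      proof (rule ccontr)
        assume yH: "y \<notin> H"
        have "\<exists>K\<in>\<H>. x [^] k \<otimes> y \<in> K" for k :: nat
        proof -
          have "x [^] k \<otimes> y \<notin> H"
          proof
            assume xy: "x [^] k \<otimes> y \<in> H"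
            have "x [^] k \<in> H"
              using H xH by (induction k) (auto intro: subgroup.one_closed subgroup.m_closed)
            then have "inv (x [^] k) \<otimes> (x [^] k \<otimes> y) \<in> H"
              by (rule subgroup.m_closed[OF H subgroup.m_inv_closed[OF H] xy])
            moreover have "inv (x [^] k) \<otimes> (x [^] k \<otimes> y) = y"
              using x y by (simp add: m_assoc[symmetric])
            ultimately show False using yH by simp
          qed
          with insert.prems(3) x y show ?thesis by (auto dest!: subsetD[where c = "x [^] k \<otimes> y"])
        qed
        then obtain K where K: "\<And>k :: nat. K k \<in> \<H>" "\<And>k. x [^] k \<otimes> y \<in> K k" by metis
        have "\<not> inj K"
        proof
          assume "inj K"
          then have "finite (UNIV :: nat set)"
            using K(1) insert.hyps(1) by (intro inj_on_finite[of K UNIV \<H>]) auto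
          then show False by simp
        qed
        then obtain k l where kl: "k < l" "K k = K l"
          unfolding inj_def by (metis nat_neq_iff)
        have L: "subgroup (K l) G" using insert.prems(1) K(1) by simp
        have "x [^] l \<otimes> y = x [^] (l - k) \<otimes> (x [^] k \<otimes> y)"
          using x y kl(1) by (simp add: m_assoc[symmetric] nat_pow_mult)
        then have "x [^] (l - k) = (x [^] l \<otimes> y) \<otimes> inv (x [^] k \<otimes> y)"
          using x y by (simp add: m_assoc)
        also have "\<dots> \<in> K l"
          using K(2)[of l] K(2)[of k, unfolded kl(2)]
          by (rule subgroup.m_closed[OF L _ subgroup.m_inv_closed[OF L]])
        finally have "x \<in> K l"
          using insert.prems(2)[of "K l" x "l - k"] K(1) x kl(1) by auto
        then show False using x(2) K(1) by blast
      qed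
    qed
    then have "H = carrier G" using subgroup.subset[OF H] by blast
    then show ?thesis by simp
  qed
qed

text \<open>In an R-group the equalizer of two homomorphisms is closed under roots: if \<open>h\<close> and \<open>h'\<close> agree at
\<open>x\<^sup>n\<close>, then \<open>h x\<close> and \<open>h' x\<close> have the same \<open>n\<close>-th power. So the equalizers of the finitely many
pairs of distinct homomorphisms, being proper, do not cover the group. Extensionality makes
distinct functions differ on the carrier.\<close>

lemma R_group_separating_point:
  fixes G (structure)
  assumes R: "R_group G" and \<H>: "finite \<H>" "\<H> \<subseteq> hom G G \<inter> extensional (carrier G)"
  obtains d where "d \<in> carrier G" "inj_on (\<lambda>h. h d) \<H>"
proof -
  interpret group G using R by (simp add: R_group_def)
  define E where "E h h' = {x \<in> carrier G. h x = h' x}" for h h' :: "'a \<Rightarrow> 'a"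
  define \<E> where "\<E> = (\<lambda>(h, h'). E h h') ` {(h, h') \<in> \<H> \<times> \<H>. h \<noteq> h'}"
  have hom: "h \<in> hom G G" if "h \<in> \<H>" for h using \<H>(2) that by auto
  have sub: "subgroup (E h h') G" if "h \<in> \<H>" "h' \<in> \<H>" for h h'
  proof -
    interpret h: group_hom G G h using hom[OF that(1)] by unfold_locales
    interpret h': group_hom G G h' using hom[OF that(2)] by unfold_locales
    show ?thesis by (rule subgroupI) (auto simp: E_def)
  qed
  have root: "x \<in> E h h'"
    if "h \<in> \<H>" "h' \<in> \<H>" "x \<in> carrier G" "0 < n" "x [^] (n::nat) \<in> E h h'" for h h' x n
  proof -
    have "h x [^] n = h' x [^] n"
      using that hom by (simp add: E_def hom_nat_pow[OF _ _ is_group is_group])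
    moreover have "h x \<in> carrier G" "h' x \<in> carrier G"
      using that hom by (auto simp: hom_def)
    moreover have "1 \<le> n" using that(4) by simp
    moreover have "\<forall>n::nat. n \<ge> 1 \<longrightarrow>
        (\<forall>x\<in>carrier G. \<forall>y\<in>carrier G. x [^] n = y [^] n \<longrightarrow> x = y)"
      using R unfolding R_group_def by (rule conjunct2)
    ultimately have "h x = h' x" by simp
    then show ?thesis using that(3) by (simp add: E_def)
  qed
  have "carrier G \<notin> \<E>"
  proof
    assume "carrier G \<in> \<E>"
    then obtain h h' where h: "h \<in> \<H>" "h' \<in> \<H>" "h \<noteq> h'" "carrier G = E h h'"
      by (auto simp: \<E>_def)
    have "h = h'"
    proof (rule extensionalityI)
      show "h \<in> extensional (carrier G)" "h' \<in> extensional (carrier G)" using h(1,2) \<H>(2) by auto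
      show "h x = h' x" if "x \<in> carrier G" for x
      proof -
        have "x \<in> E h h'" using that h(4) by (rule subst[rotated])
        then show ?thesis by (simp add: E_def)
      qed
    qed
    with h(3) show False ..
  qed
  moreover have "finite \<E>"
    unfolding \<E>_def by (rule finite_imageI, rule finite_subset[of _ "\<H> \<times> \<H>"]) (use \<H>(1) in auto)
  moreover have "carrier G \<in> \<E>" if "finite \<E>" "carrier G \<subseteq> \<Union>\<E>"
  proof (rule root_closed_cover[OF that(1) _ _ that(2)])
    show "subgroup K G" if "K \<in> \<E>" for K using that sub by (auto simp: \<E>_def)
    show "x \<in> K" if "K \<in> \<E>" "x \<in> carrier G" "0 < n" "x [^] n \<in> K" for K x and n :: nat
      using that(1) root[OF _ _ that(2,3)] that(4) by (auto simp: \<E>_def)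
  qed
  ultimately have "\<not> carrier G \<subseteq> \<Union>\<E>" by blast
  then obtain d where d: "d \<in> carrier G" "d \<notin> \<Union>\<E>" by blast
  have "inj_on (\<lambda>h. h d) \<H>"
  proof (rule inj_onI, rule ccontr)
    fix h h' assume h: "h \<in> \<H>" "h' \<in> \<H>" "h d = h' d" "h \<noteq> h'"
    then have "E h h' \<in> \<E>" by (auto simp: \<E>_def)
    moreover have "d \<in> E h h'" using h d by (simp add: E_def)
    ultimately show False using d(2) by blast
  qed
  with d(1) show ?thesis by (rule that)
qed

text \<open>The \<open>n + 1\<close> values of \<open>n + 1\<close> different homomorphisms at a point separating them would not fit into
one fibre.\<close>

lemma R_group_finite_homs_in_bounded_relation:
  assumes R: "R_group G"
    and X: "\<forall>x\<in>carrier G. finite {y \<in> carrier G. X x y} \<and> card {y \<in> carrier G. X x y} \<le> n"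
  shows "finite {h \<in> hom G G \<inter> extensional (carrier G). \<forall>x\<in>carrier G. X x (h x)}" (is "finite ?H")
proof (rule ccontr)
  assume "infinite ?H"
  then obtain \<H> where \<H>: "finite \<H>" "card \<H> = Suc n" "\<H> \<subseteq> ?H"
    using infinite_arbitrarily_large by blast
  then have "\<H> \<subseteq> hom G G \<inter> extensional (carrier G)" by blast
  with R \<H>(1) obtain d where d: "d \<in> carrier G" "inj_on (\<lambda>h. h d) \<H>"
    by (rule R_group_separating_point)
  have "(\<lambda>h. h d) ` \<H> \<subseteq> {y \<in> carrier G. X d y}"
    using \<H>(3) d(1) by (auto simp: hom_def)
  with X d(1) have "card ((\<lambda>h. h d) ` \<H>) \<le> card {y \<in> carrier G. X d y}" by (intro card_mono) auto
  also have "\<dots> \<le> n" using X d(1) by auto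
  finally show False using card_image[OF d(2)] \<H>(2) by simp
qed

section \<open>Choice from finite sets\<close>

text \<open>Tychonoff's theorem for the product of the finite discrete spaces \<open>X i\<close>. The condition \<open>Q A\<close> cuts out
a closed set, because it depends on finitely many coordinates, and antitonicity of \<open>Q\<close> yields the
finite intersection property.\<close>

lemma finite_choice_compactness:
  fixes X :: "'i \<Rightarrow> 'b set" and Q :: "'i set \<Rightarrow> ('i \<Rightarrow> 'b) \<Rightarrow> bool"
  assumes fin: "\<And>i. i \<in> I \<Longrightarrow> finite (X i)"
    and coord: "\<And>A h h'. A \<subseteq> I \<Longrightarrow> (\<And>i. i \<in> A \<Longrightarrow> h i = h' i) \<Longrightarrow> Q A h \<Longrightarrow> Q A h'"
    and anti: "\<And>A B h. A \<subseteq> B \<Longrightarrow> B \<subseteq> I \<Longrightarrow> Q B h \<Longrightarrow> Q A h"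
    and ex: "\<And>A. finite A \<Longrightarrow> A \<subseteq> I \<Longrightarrow> \<exists>h. (\<forall>i\<in>A. h i \<in> X i) \<and> Q A h"
  obtains h where "\<forall>i\<in>I. h i \<in> X i" "\<forall>A. finite A \<longrightarrow> A \<subseteq> I \<longrightarrow> Q A h"
proof -
  define T where "T = product_topology (\<lambda>i. discrete_topology (X i)) I"
  define C where "C A = {h \<in> Pi\<^sub>E I X. Q A h}" for A
  have top: "topspace T = Pi\<^sub>E I X" by (simp add: T_def)
  have compact: "compact_space T"
    unfolding T_def compact_space_product_topology using fin by (simp add: compact_space_discrete_topology)
  have ne: "C A \<noteq> {}" if A: "finite A" "A \<subseteq> I" for A
  proof -
    have "X i \<noteq> {}" if "i \<in> I" for i using ex[of "{i}"] that by auto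
    then obtain k where k: "k \<in> Pi\<^sub>E I X" by (metis PiE_eq_empty_iff all_not_in_conv)
    obtain h where h: "\<forall>i\<in>A. h i \<in> X i" "Q A h" using ex[OF A] by blast
    define h' where "h' i = (if i \<in> A then h i else k i)" for i
    have "h' \<in> Pi\<^sub>E I X" using h(1) k A(2) by (auto simp: h'_def PiE_def extensional_def)
    moreover have "Q A h'" using A(2) _ h(2) by (rule coord) (simp add: h'_def)
    ultimately show ?thesis by (auto simp: C_def)
  qed
  have closed: "closedin T (C A)" if A: "finite A" "A \<subseteq> I" for A
  proof -
    have "openin T (topspace T - C A)"
    proof (subst openin_subopen, rule ballI)
      fix h assume "h \<in> topspace T - C A"
      then have h: "h \<in> Pi\<^sub>E I X" "\<not> Q A h" by (auto simp: top C_def)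
      define V where "V = Pi\<^sub>E I (\<lambda>i. if i \<in> A then {h i} else X i)"
      have "openin T V"
        unfolding T_def V_def openin_PiE_gen
        using h(1) A(1) by (auto intro: finite_subset[of _ A])
      moreover have "h \<in> V" using h(1) by (auto simp: V_def PiE_iff)
      moreover have "V \<subseteq> topspace T - C A"
      proof
        fix k assume k: "k \<in> V"
        then have "k i = h i" if "i \<in> A" for i
          using PiE_mem[OF k[unfolded V_def], of i] that A(2) by auto
        then have "\<not> Q A k" using coord[OF A(2), of k h] h(2) by blast
        moreover have "k \<in> Pi\<^sub>E I X"
        proof (rule PiE_I)
          show "k i \<in> X i" if "i \<in> I" for i
            using PiE_mem[OF k[unfolded V_def] that] h(1) that by (auto split: if_splits)
          show "k i = undefined" if "i \<notin> I" for i
            using PiE_arb[OF k[unfolded V_def] that] .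
        qed
        ultimately show "k \<in> topspace T - C A" by (simp add: top C_def)
      qed
      ultimately show "\<exists>V. openin T V \<and> h \<in> V \<and> V \<subseteq> topspace T - C A" by blast
    qed
    moreover have "C A \<subseteq> topspace T" by (auto simp: C_def top)
    ultimately show ?thesis by (simp add: closedin_def)
  qed
  define \<F> where "\<F> = {A. finite A \<and> A \<subseteq> I}"
  have "\<Inter>\<G> \<noteq> {}" if \<G>: "finite \<G>" "\<G> \<subseteq> C ` \<F>" for \<G>
  proof -
    obtain \<A> where \<A>: "\<A> \<subseteq> \<F>" "finite \<A>" "\<G> = C ` \<A>"
      using finite_subset_image[OF \<G>] by blast
    have U: "finite (\<Union>\<A>)" "\<Union>\<A> \<subseteq> I" using \<A> by (auto simp: \<F>_def)
    have "C (\<Union>\<A>) \<subseteq> C A" if "A \<in> \<A>" for A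
    proof -
      have "A \<subseteq> \<Union>\<A>" using that by auto
      then show ?thesis using anti[OF _ U(2)] by (auto simp: C_def)
    qed
    then have "C (\<Union>\<A>) \<subseteq> \<Inter>\<G>" unfolding \<A>(3) by blast
    with ne[OF U] show ?thesis by auto
  qed
  moreover have "\<forall>D\<in>C ` \<F>. closedin T D" using closed by (auto simp: \<F>_def)
  ultimately have "\<Inter>(C ` \<F>) \<noteq> {}"
    using compact[unfolded compact_space_fip, THEN spec[of _ "C ` \<F>"]] by blast
  then obtain h where h: "\<forall>A\<in>\<F>. h \<in> C A" by auto
  have "h \<in> C {}" using h by (simp add: \<F>_def)
  then have "\<forall>i\<in>I. h i \<in> X i" by (auto simp: C_def)
  moreover have "\<forall>A. finite A \<longrightarrow> A \<subseteq> I \<longrightarrow> Q A h" using h by (auto simp: \<F>_def C_def)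
  ultimately show ?thesis by (rule that)
qed

section \<open>Extending partial homomorphisms\<close>

text \<open>The set \<open>S\<close> is part of the graph of a function that is contained in \<open>X\<close> and respects those products
that can be read off from \<open>S\<close>.\<close>

definition consistent :: "('a, 'b) monoid_scheme \<Rightarrow> ('a \<Rightarrow> 'a \<Rightarrow> bool) \<Rightarrow> ('a \<times> 'a) set \<Rightarrow> bool" where
  "consistent G X S \<longleftrightarrow>
     (\<forall>p\<in>S. X (fst p) (snd p)) \<and>
     (\<forall>p\<in>S. \<forall>q\<in>S. fst p = fst q \<longrightarrow> snd p = snd q) \<and>
     (\<forall>p\<in>S. \<forall>q\<in>S. \<forall>r\<in>S. fst p \<otimes>\<^bsub>G\<^esub> fst q = fst r \<longrightarrow> snd p \<otimes>\<^bsub>G\<^esub> snd q = snd r)"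

text \<open>A game of \<open>j\<close> rounds: the opponent names points, the player answers with values, and the pairs have
to be consistent in the end. The existence of a homomorphism inside \<open>X\<close> extending \<open>S\<close> is a second-order
condition, while winning the game of length \<open>j\<close> is first-order; the game replaces the more
obvious condition that values on every \<open>j\<close> points can be chosen simultaneously, because its
recursion adds one pair of quantifiers at a time.\<close>

primrec extendable ::
  "('a, 'b) monoid_scheme \<Rightarrow> ('a \<Rightarrow> 'a \<Rightarrow> bool) \<Rightarrow> nat \<Rightarrow> ('a \<times> 'a) set \<Rightarrow> bool" where
  "extendable G X 0 S \<longleftrightarrow> consistent G X S"
| "extendable G X (Suc j) S \<longleftrightarrow>
     (\<forall>x\<in>carrier G. \<exists>y\<in>carrier G. extendable G X j (insert (x, y) S))"

lemma consistent_mem: "consistent G X S \<Longrightarrow> (x, y) \<in> S \<Longrightarrow> X x y"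
  unfolding consistent_def by (drule conjunct1, drule (1) bspec) simp

lemma consistent_unique:
  "consistent G X S \<Longrightarrow> (x, y) \<in> S \<Longrightarrow> (x, z) \<in> S \<Longrightarrow> y = z"
  unfolding consistent_def by (drule conjunct2, drule conjunct1, drule (1) bspec, drule (1) bspec) simp

lemma consistent_mult:
  "consistent G X S \<Longrightarrow> (x, y) \<in> S \<Longrightarrow> (x', y') \<in> S \<Longrightarrow> (x \<otimes>\<^bsub>G\<^esub> x', z) \<in> S \<Longrightarrow>
    z = y \<otimes>\<^bsub>G\<^esub> y'"
  unfolding consistent_def
  by (drule conjunct2, drule conjunct2, drule (1) bspec, drule (1) bspec, drule (1) bspec) simp

lemma consistent_subset: "consistent G X S \<Longrightarrow> T \<subseteq> S \<Longrightarrow> consistent G X T"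
  unfolding consistent_def by (blast dest: subsetD)

text \<open>The longer game contains the shorter one: the pair from an additional round can be dropped in
the end.\<close>

lemma (in monoid) extendable_Suc_imp: "extendable G X (Suc j) S \<Longrightarrow> extendable G X j S"
proof (induction j arbitrary: S)
  case 0
  then obtain y where "consistent G X (insert (\<one>, y) S)" by auto
  then show ?case by (auto elim: consistent_subset)
next
  case (Suc j)
  show ?case unfolding extendable.simps
  proof
    fix x assume "x \<in> carrier G"
    with Suc.prems obtain y where "y \<in> carrier G" "extendable G X (Suc j) (insert (x, y) S)"
      by (auto simp only: extendable.simps(2)[of _ _ "Suc j"])
    with Suc.IH show "\<exists>y\<in>carrier G. extendable G X j (insert (x, y) S)" by blast
  qed
qed

lemma (in monoid) extendable_antimono:
  assumes "i \<le> j" "extendable G X j S"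
  shows "extendable G X i S"
  using assms by (induction rule: dec_induct) (auto dest: extendable_Suc_imp simp del: extendable.simps)

lemma extendable_graph:
  assumes f: "f \<in> hom G G" "\<And>x. x \<in> carrier G \<Longrightarrow> X x (f x)"
    and S: "S \<subseteq> (\<lambda>x. (x, f x)) ` carrier G"
  shows "extendable G X j S"
  using S
proof (induction j arbitrary: S)
  case 0
  have "consistent G X ((\<lambda>x. (x, f x)) ` carrier G)"
    using f by (auto simp: consistent_def hom_def)
  with 0 show ?case by (auto intro: consistent_subset)
next
  case (Suc j)
  have "extendable G X j (insert (x, f x) S)" if "x \<in> carrier G" for x
    using Suc.prems that by (intro Suc.IH) auto
  moreover have "f x \<in> carrier G" if "x \<in> carrier G" for x using f(1) that by (auto simp: hom_def)
  ultimately show ?case by auto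
qed

lemma extendable_consistent:
  assumes "finite A" "A \<subseteq> carrier G" "extendable G X (card A) S" "S \<subseteq> carrier G \<times> carrier G"
  shows "\<exists>S'. S \<subseteq> S' \<and> S' \<subseteq> carrier G \<times> carrier G \<and> A \<subseteq> fst ` S' \<and> consistent G X S'"
  using assms
proof (induction A arbitrary: S rule: finite_induct)
  case empty
  then show ?case by auto
next
  case (insert a A)
  then obtain y where y: "y \<in> carrier G" "extendable G X (card A) (insert (a, y) S)" by auto
  have "insert (a, y) S \<subseteq> carrier G \<times> carrier G" using insert.prems y(1) by simp
  with insert.IH[OF _ y(2)] insert.prems(1) obtain S' where S': "insert (a, y) S \<subseteq> S'"
    "S' \<subseteq> carrier G \<times> carrier G" "A \<subseteq> fst ` S'" "consistent G X S'"
    by auto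
  moreover have "a \<in> fst ` S'" using S'(1) by (intro image_eqI[of _ _ "(a, y)"]) auto
  ultimately show ?case by (intro exI[of _ S']) simp
qed

text \<open>A player who can survive every finite number of rounds has consistent answers on each finite set of
points. As the fibres of \<open>X\<close> are finite, compactness produces answers on the whole group, and these
form a homomorphism.\<close>

lemma extendable_imp_hom:
  fixes G (structure)
  assumes "group G" and fin: "\<And>x. x \<in> carrier G \<Longrightarrow> finite {y \<in> carrier G. X x y}"
    and S: "S \<subseteq> carrier G \<times> carrier G" and ext: "\<And>j. extendable G X j S"
  obtains h where "h \<in> hom G G \<inter> extensional (carrier G)" "\<forall>x\<in>carrier G. X x (h x)"
    "\<forall>(x, y)\<in>S. h x = y"
proof -
  interpret group G by fact
  define Q where "Q A h \<longleftrightarrow> consistent G X (S \<union> (\<lambda>x. (x, h x)) ` A)" for A h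
  have ex: "\<exists>h. (\<forall>x\<in>A. h x \<in> {y \<in> carrier G. X x y}) \<and> Q A h"
    if A: "finite A" "A \<subseteq> carrier G" for A
  proof -
    obtain S' where S': "S \<subseteq> S'" "S' \<subseteq> carrier G \<times> carrier G" "A \<subseteq> fst ` S'" "consistent G X S'"
      using extendable_consistent[OF A ext S] by (elim exE conjE)
    have "\<forall>x\<in>A. \<exists>y. (x, y) \<in> S'"
    proof
      fix x assume "x \<in> A"
      with S'(3) obtain p where "p \<in> S'" "x = fst p" by blast
      then have "(x, snd p) \<in> S'" by simp
      then show "\<exists>y. (x, y) \<in> S'" ..
    qed
    then obtain h where h: "\<forall>x\<in>A. (x, h x) \<in> S'" by (rule exE[OF bchoice])
    have "h x \<in> carrier G \<and> X x (h x)" if "x \<in> A" for x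
      using consistent_mem[OF S'(4) bspec[OF h that]] subsetD[OF S'(2) bspec[OF h that]] by simp
    then have "\<forall>x\<in>A. h x \<in> {y \<in> carrier G. X x y}" by simp
    moreover have "Q A h"
      unfolding Q_def using S'(4) by (rule consistent_subset) (use S'(1) h in auto)
    ultimately show ?thesis by blast
  qed
  obtain h where h: "\<forall>x\<in>carrier G. h x \<in> {y \<in> carrier G. X x y}"
    "\<forall>A. finite A \<longrightarrow> A \<subseteq> carrier G \<longrightarrow> Q A h"
  proof (rule finite_choice_compactness[of "carrier G" "\<lambda>x. {y \<in> carrier G. X x y}" Q])
    show "Q A h'" if "\<And>i. i \<in> A \<Longrightarrow> h i = h' i" "Q A h" for A h h'
    proof -
      have "(\<lambda>x. (x, h x)) ` A = (\<lambda>x. (x, h' x)) ` A" using that(1) by (intro image_cong) auto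
      with that(2) show ?thesis by (simp add: Q_def)
    qed
    show "Q A h" if "A \<subseteq> B" "Q B h" for A B h
      using that(2) unfolding Q_def by (rule consistent_subset) (use that(1) in auto)
  qed (use fin ex in blast)+
  have carr: "h x \<in> carrier G" "X x (h x)" if "x \<in> carrier G" for x using h(1) that by auto
  have mult: "h (x \<otimes> y) = h x \<otimes> h y" if "x \<in> carrier G" "y \<in> carrier G" for x y
  proof -
    have "Q {x, y, x \<otimes> y} h" using h(2) that by simp
    then show ?thesis unfolding Q_def by (rule consistent_mult[where x = x and x' = y]) auto
  qed
  have "h x = y" if "(x, y) \<in> S" for x y
  proof -
    have "Q {x} h" using h(2) S that by auto
    then show ?thesis unfolding Q_def by (rule consistent_unique[where x = x]) (use that in auto)
  qed
  then have "\<forall>(x, y)\<in>S. restrict h (carrier G) x = y" using S by auto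
  moreover have "restrict h (carrier G) \<in> hom G G \<inter> extensional (carrier G)"
    using carr mult by (auto simp: hom_def)
  moreover have "\<forall>x\<in>carrier G. X x (restrict h (carrier G) x)" using carr by simp
  ultimately show ?thesis by (intro that)
qed

text \<open>The coding of a finite set of pairs by an environment. Each pair stores its second component
first, since the player's answer is the variable bound last.\<close>

definition pairs :: "nat \<Rightarrow> (nat \<Rightarrow> 'a) \<Rightarrow> ('a \<times> 'a) set" where
  "pairs m e = (\<lambda>i. (e (Suc (2 * i)), e (2 * i))) ` {..<m}"

lemma pairs_Suc: "pairs (Suc m) (case_nat y (case_nat x e)) = insert (x, y) (pairs m e)"
  by (simp add: pairs_def lessThan_Suc_eq_insert_0 image_image)

lemma expressible_extendable:
  assumes U: "univ M = carrier G"
    and mult: "expressible M A (\<lambda>e. e 0 \<otimes>\<^bsub>G\<^esub> e 1 = e 2)"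
    and X: "expressible M A (\<lambda>e. X (e 0) (e 1))"
  shows "expressible M A (\<lambda>e. extendable G X j (pairs m e))"
proof (induction j arbitrary: m)
  case 0
  have A: "A \<subseteq> univ M" using X by (simp add: expressible_def)
  have mult': "expressible M A (\<lambda>e. e i \<otimes>\<^bsub>G\<^esub> e j = e k)" for i j k
    using expressible_rename[OF mult, of "case_nat i (case_nat j (\<lambda>_. k))"]
    by (simp add: numeral_2_eq_2)
  have "expressible M A (\<lambda>e.
     (\<forall>i\<in>{..<m}. X (e (Suc (2 * i))) (e (2 * i))) \<and>
     (\<forall>i\<in>{..<m}. \<forall>j\<in>{..<m}. e (Suc (2 * i)) = e (Suc (2 * j)) \<longrightarrow> e (2 * i) = e (2 * j)) \<and>
     (\<forall>i\<in>{..<m}. \<forall>j\<in>{..<m}. \<forall>k\<in>{..<m}. e (Suc (2 * i)) \<otimes>\<^bsub>G\<^esub> e (Suc (2 * j)) = e (Suc (2 * k)) \<longrightarrow>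
        e (2 * i) \<otimes>\<^bsub>G\<^esub> e (2 * j) = e (2 * k)))"
    by (intro expressible_conj expressible_ball expressible_imp expressible_binary[OF X]
        expressible_eq mult' A finite_lessThan)
  then show ?case by (simp add: consistent_def pairs_def)
next
  case (Suc j)
  from expressible_all[OF expressible_ex[OF Suc.IH[of "Suc m"]]]
  show ?case by (simp add: pairs_Suc U)
qed

section \<open>Definability of homomorphisms\<close>

lemma group_multiplication_expressible:
  assumes "expands_group M G" "group G"
  shows "univ M = carrier G" "expressible M (carrier G) (\<lambda>e. e 0 \<otimes>\<^bsub>G\<^esub> e 1 = e 2)"
proof -
  interpret group G by fact
  show U: "univ M = carrier G"
    using assms(1) by (simp add: expands_group_def expansion_over_def group_struct_def)
  define X where "X = {[x, y, x \<otimes>\<^bsub>G\<^esub> y] | x y. x \<in> carrier G \<and> y \<in> carrier G}"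
  have "definable_over (group_struct G) {} 3 X"
    unfolding definable_over_def
  proof (intro exI conjI)
    show "X = {xs \<in> tuples (group_struct G) 3.
        sat (group_struct G) (\<lambda>i. (xs @ []) ! i) (Equal (App () [Var 0, Var 1]) (Var 2))}"
      by (auto simp: X_def tuples_def group_struct_def length_Suc_conv numeral_eq_Suc)
  qed (auto simp: group_struct_def)
  then have "definable_over M (carrier G) 3 X"
    using assms(1) by (simp add: expands_group_def expansion_over_def)
  then have *: "expressible M (carrier G) (\<lambda>e. map e [0..<3] \<in> X)"
    by (rule definable_expressible) (simp add: U)
  have "map e [0..<3] \<in> X \<longleftrightarrow> e 0 \<otimes>\<^bsub>G\<^esub> e 1 = e 2" if "range e \<subseteq> univ M" for e
    using that U by (auto simp: X_def upt_rec numeral_eq_Suc)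
  then show "expressible M (carrier G) (\<lambda>e. e 0 \<otimes>\<^bsub>G\<^esub> e 1 = e 2)"
    using * by (rule expressible_cong[THEN iffD1])
qed

text \<open>The first part of the theorem. The relation \<open>T j x y\<close> says that the value \<open>y\<close> at \<open>x\<close>, together with the
value of \<open>f\<close> at the separating point \<open>d\<close>, is extendable for \<open>j\<close> rounds. All \<open>T j\<close> contain the graph of \<open>f\<close>,
they decrease with \<open>j\<close>, and their intersection within \<open>X\<close> is the graph of \<open>f\<close>. Saturation of \<open>N\<close>, where
\<open>f\<close> is available as a parameter-definable map, turns this infinite intersection into a single \<open>T K\<close>.\<close>

lemma algebraic_hom_definable:
  fixes G :: "('a, 'b) monoid_scheme"
    and M :: "('a, 'f, 'r) fo_struct" and N :: "('a, 'g, 's) fo_struct"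
  assumes R: "R_group G" and MG: "expands_group M G"
    and NM: "expansion_over {} N M" and sat: "omega_saturated N"
    and f: "f \<in> hom G G" "definable_map N f"
    and F: "finite F" "F \<subseteq> carrier G" "\<And>g. g \<in> carrier G \<Longrightarrow> f g \<in> acl M (F \<union> {g})"
  shows "definable_map M f"
proof -
  interpret group G using R by (simp add: R_group_def)
  have UM: "univ M = carrier G" by (rule group_multiplication_expressible[OF MG is_group])
  have UN: "univ N = carrier G" using NM UM by (simp add: expansion_over_def)
  have fc: "f x \<in> carrier G" if "x \<in> carrier G" for x using f(1) that by (auto simp: hom_def)
  obtain A where A: "finite A" "A \<subseteq> carrier G" "expressible M A (\<lambda>e. e 0 \<otimes>\<^bsub>G\<^esub> e 1 = e 2)"
    by (rule expressible_finite_params[OF group_multiplication_expressible(2)[OF MG is_group]])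
  have "expressible N (univ N) (\<lambda>e. f (e 0) = e 1)"
    using f fc UN by (subst definable_map_iff[symmetric]) auto
  then obtain B where B: "finite B" "B \<subseteq> univ N" "expressible N B (\<lambda>e. f (e 0) = e 1)"
    by (rule expressible_finite_params)
  obtain X n where X: "expressible M F (\<lambda>e. X (e 0) (e 1))"
    "\<forall>x\<in>univ M. finite {y \<in> univ M. X x y} \<and> card {y \<in> univ M. X x y} \<le> n"
    "\<forall>x\<in>univ M. X x (f x)"
  proof (rule algebraic_map_bounded_relation[OF NM sat F(1) _ _ B(1,3)])
    show "F \<subseteq> univ M" "f \<in> univ M \<rightarrow> univ M" using F(2) fc UM by auto
    show "f g \<in> acl M (F \<union> {g})" if "g \<in> univ M" for g using F(3) that UM by simp
  qed
  note X = X[unfolded UM]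
  define \<H> where "\<H> = {h \<in> hom G G \<inter> extensional (carrier G). \<forall>x\<in>carrier G. X x (h x)}"
  have "finite \<H>" unfolding \<H>_def by (rule R_group_finite_homs_in_bounded_relation[OF R X(2)])
  moreover have "\<H> \<subseteq> hom G G \<inter> extensional (carrier G)" by (auto simp: \<H>_def)
  ultimately obtain d where d: "d \<in> carrier G" "inj_on (\<lambda>h. h d) \<H>"
    by (rule R_group_separating_point[OF R])
  have f\<H>: "restrict f (carrier G) \<in> \<H>"
    using f(1) X(3) by (auto simp: \<H>_def hom_def)
  define T where "T j x y \<longleftrightarrow> extendable G X j {(d, f d), (x, y)}" for j x y
  have T_f: "T j x (f x)" if "x \<in> carrier G" for j x
    unfolding T_def by (rule extendable_graph) (use f(1) X(3) d(1) that in auto)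
  \<comment> \<open>Any homomorphism inside \<open>X\<close> agreeing with \<open>f\<close> at \<open>d\<close> is \<open>f\<close>, since \<open>d\<close> separates the elements of \<open>\<H>\<close>.\<close>
  have T_only_f: "\<exists>j. \<not> T j x y" if xy: "x \<in> carrier G" "y \<in> carrier G" "f x \<noteq> y" for x y
  proof (rule ccontr)
    assume "\<nexists>j. \<not> T j x y"
    then have ext: "extendable G X j {(d, f d), (x, y)}" for j by (simp add: T_def)
    obtain h where h: "h \<in> hom G G \<inter> extensional (carrier G)" "\<forall>x\<in>carrier G. X x (h x)"
      "\<forall>(x, y)\<in>{(d, f d), (x, y)}. h x = y"
      by (rule extendable_imp_hom[OF is_group _ _ ext]) (use X(2) xy d(1) fc in auto)
    then have "h \<in> \<H>" "h d = restrict f (carrier G) d" using d(1) by (auto simp: \<H>_def)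
    then have "h = restrict f (carrier G)" using inj_onD[OF d(2) _ _ f\<H>] by blast
    then show False using h(3) xy by auto
  qed
  have T_anti: "T i x y" if "i \<le> j" "T j x y" for i j x y
    using that unfolding T_def by (rule extendable_antimono)
  define C where "C = A \<union> F \<union> {d, f d}"
  have C: "finite C" "C \<subseteq> univ M" using A F d(1) fc UM by (auto simp: C_def)
  have XC: "expressible M C (\<lambda>e. X (e 0) (e 1))"
    using X(1) by (rule expressible_mono) (use C in \<open>auto simp: C_def\<close>)
  have TC: "expressible M C (\<lambda>e. T j (e 0) (e 1))" for j
  proof -
    have "expressible M C (\<lambda>e. e 0 \<otimes>\<^bsub>G\<^esub> e 1 = e 2)"
      using A(3) by (rule expressible_mono) (use C in \<open>auto simp: C_def\<close>)
    from expressible_extendable[OF UM this XC]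
    have "expressible M C (\<lambda>e. extendable G X j (pairs 2 e))" .
    from expressible_rename[OF this, of "case_nat 1 (case_nat 0 (case_nat 3 (\<lambda>_. 2)))"]
    have "expressible M C (\<lambda>e. extendable G X j {(e 0, e 1), (e 2, e 3)})"
      by (simp add: pairs_def lessThan_Suc numeral_eq_Suc insert_commute)
    from expressible_param[OF this, of d]
    have "expressible M C (\<lambda>e. extendable G X j {(d, e 0), (e 1, e 2)})"
      by (simp add: C_def numeral_eq_Suc)
    from expressible_param[OF this, of "f d"]
    show ?thesis by (simp add: T_def C_def numeral_eq_Suc)
  qed
  \<comment> \<open>\<open>D j x\<close>: among the points of the fibre of \<open>X\<close> at \<open>x\<close>, \<open>j\<close> rounds refute all but \<open>f x\<close>.\<close>
  define D where "D j x \<longleftrightarrow> (\<forall>y\<in>univ N. X x y \<and> f x \<noteq> y \<longrightarrow> \<not> T j x y)" for j x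
  have D_expr: "expressible N (B \<union> C) (\<lambda>e. D j (e 0))" for j
  proof -
    have BC: "B \<union> C \<subseteq> univ N" using B(2) C(2) UM UN by auto
    have 1: "expressible N (B \<union> C) (\<lambda>e. X (e 0) (e 1))"
      by (rule expressible_mono[OF expressible_expansion[OF NM XC] _ BC]) auto
    have 2: "expressible N (B \<union> C) (\<lambda>e. T j (e 0) (e 1))"
      by (rule expressible_mono[OF expressible_expansion[OF NM TC] _ BC]) auto
    have 3: "expressible N (B \<union> C) (\<lambda>e. f (e 0) = e 1)"
      by (rule expressible_mono[OF B(3) _ BC]) auto
    have "expressible N (B \<union> C) (\<lambda>e. X (e 1) (e 0) \<and> f (e 1) \<noteq> e 0 \<longrightarrow> \<not> T j (e 1) (e 0))"
      by (intro expressible_imp expressible_conj expressible_neg expressible_binary[OF 1]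
          expressible_binary[OF 2] expressible_binary[OF 3])
    from expressible_all[OF this] show ?thesis by (simp add: D_def)
  qed
  have D_cover: "\<exists>j\<in>UNIV. D j x" if "x \<in> univ N" for x
  proof -
    have x: "x \<in> carrier G" using that UN by simp
    define Y where "Y = {y \<in> carrier G. X x y \<and> f x \<noteq> y}"
    have "finite Y" using X(2) x by (auto simp: Y_def intro: finite_subset[of _ "{y \<in> carrier G. X x y}"])
    have "\<forall>y\<in>Y. \<exists>j. \<not> T j x y" using T_only_f x by (auto simp: Y_def)
    then obtain j where j: "\<forall>y\<in>Y. \<not> T (j y) x y" by (rule exE[OF bchoice])
    \<comment> \<open>One length refutes all of the finitely many wrong values; the sum is an upper bound of the \<open>j y\<close>.\<close>
    have "\<not> T (sum j Y) x y" if "y \<in> Y" for y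
      using j T_anti[of "j y" "sum j Y" x y] member_le_sum[of y Y j] that \<open>finite Y\<close> by auto
    then have "D (sum j Y) x" by (auto simp: D_def Y_def UN)
    then show ?thesis by blast
  qed
  have "finite (B \<union> C)" "B \<union> C \<subseteq> univ N" using B(1,2) C UM UN by auto
  then obtain J where J: "finite J" "\<forall>x\<in>univ N. \<exists>j\<in>J. D j x"
    using saturated_finite_subcover[OF sat _ _ D_expr D_cover] by metis
  define K where "K = Max (insert 0 J)"
  have "X (e 0) (e 1) \<and> T K (e 0) (e 1) \<longleftrightarrow> f (e 0) = e 1" if "range e \<subseteq> univ M" for e
  proof
    have e: "e 0 \<in> carrier G" "e 1 \<in> carrier G" using that UM by auto
    show "X (e 0) (e 1) \<and> T K (e 0) (e 1)" if "f (e 0) = e 1"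
      using that X(3) T_f e by metis
    assume XT: "X (e 0) (e 1) \<and> T K (e 0) (e 1)"
    obtain j where j: "j \<in> J" "D j (e 0)" using J(2) e UN by auto
    have "j \<le> K" using j(1) J(1) by (simp add: K_def)
    with XT have "T j (e 0) (e 1)" using T_anti by blast
    then show "f (e 0) = e 1" using j(2) XT e UN by (auto simp: D_def)
  qed
  moreover have "expressible M C (\<lambda>e. X (e 0) (e 1) \<and> T K (e 0) (e 1))"
    by (rule expressible_conj[OF XC TC])
  ultimately have "expressible M C (\<lambda>e. f (e 0) = e 1)" by (rule expressible_cong[THEN iffD1])
  then have "expressible M (univ M) (\<lambda>e. f (e 0) = e 1)"
    by (rule expressible_mono) (use C in auto)
  then show ?thesis using fc UM by (subst definable_map_iff) auto
qed

text \<open>If \<open>f\<close> is defined with parameters \<open>F\<close>, the same formula defines the singleton of \<open>f g\<close> over \<open>F\<close> and \<open>g\<close>.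
This reduces the second part of the theorem to the first one.\<close>

lemma definable_map_dcl:
  assumes f: "f \<in> univ N \<rightarrow> univ N" "definable_map N f"
  obtains F where "finite F" "F \<subseteq> univ N" "\<forall>g\<in>univ N. f g \<in> dcl N (F \<union> {g})"
proof -
  have "expressible N (univ N) (\<lambda>e. f (e 0) = e 1)"
    using f definable_map_iff by blast
  then obtain F where F: "finite F" "F \<subseteq> univ N" "expressible N F (\<lambda>e. f (e 0) = e 1)"
    by (rule expressible_finite_params)
  have "f g \<in> dcl N (F \<union> {g})" if g: "g \<in> univ N" for g
  proof -
    have fg: "f g \<in> univ N" using f(1) g by auto
    have "expressible N (F \<union> {g}) (\<lambda>e. f (e 0) = e 1)"
      using F(3) by (rule expressible_mono) (use F g in auto)
    from expressible_param[OF this, of g]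
    have "expressible N (F \<union> {g}) (\<lambda>e. map e [0..<1] \<in> {[f g]})" by (simp add: eq_commute)
    then have "definable_over N (F \<union> {g}) 1 {[f g]}"
      by (rule expressible_definable) (use fg in \<open>auto simp: tuples_def\<close>)
    with fg show ?thesis by (simp add: dcl_def)
  qed
  with F(1,2) show ?thesis by (intro that) auto
qed

theorem lemma3p1:
  fixes G :: "('a, 'b) monoid_scheme"
    and M :: "('a, 'f, 'r) fo_struct"
    and N :: "('a, 'g, 's) fo_struct"
  assumes "R_group G"
    and "is_struct M" and "expands_group M G"
    and "is_struct N" and "expansion_over {} N M" and "omega_saturated N"
  shows "(\<forall>f\<in>hom G G. definable_map N f \<longrightarrow>
            (\<exists>F. finite F \<and> F \<subseteq> carrier G \<and> (\<forall>g\<in>carrier G. f g \<in> acl M (F \<union> {g}))) \<longrightarrow>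
            definable_map M f)
       \<and> ((\<forall>A. A \<subseteq> carrier G \<longrightarrow> dcl N A \<subseteq> acl M A) \<longrightarrow>
            (\<forall>f\<in>hom G G. definable_map N f \<longrightarrow> definable_map M f))"
proof (intro conjI ballI impI)
  fix f assume f: "f \<in> hom G G" "definable_map N f"
  note main = algebraic_hom_definable[OF assms(1,3,5,6) f]
  show "definable_map M f"
    if "\<exists>F. finite F \<and> F \<subseteq> carrier G \<and> (\<forall>g\<in>carrier G. f g \<in> acl M (F \<union> {g}))"
    using that main by blast
  show "definable_map M f" if dcl: "\<forall>A. A \<subseteq> carrier G \<longrightarrow> dcl N A \<subseteq> acl M A"
  proof -
    have "group G" using assms(1) by (simp add: R_group_def)
    then have U: "univ N = carrier G"
      using group_multiplication_expressible(1)[OF assms(3)] assms(5)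
      by (simp add: expansion_over_def)
    have "f \<in> univ N \<rightarrow> univ N" using f(1) U by (simp add: hom_def)
    then obtain F where F: "finite F" "F \<subseteq> univ N" "\<forall>g\<in>univ N. f g \<in> dcl N (F \<union> {g})"
      using f(2) by (rule definable_map_dcl)
    show ?thesis
    proof (rule main)
      show "f g \<in> acl M (F \<union> {g})" if "g \<in> carrier G" for g
      proof -
        have "dcl N (F \<union> {g}) \<subseteq> acl M (F \<union> {g})" using dcl F(2) U that by simp
        then show ?thesis using F(3) U that by auto
      qed
    qed (use F U in auto)
  qed
qed

end
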